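(* Let $K$ be a totally real number field with $[K:\mathbb{Q}]=3$, and let $F$ be a $2$-dimensional face of the sail $\mathcal{S}_K$. Then \[ \iota_{\mathrm{int}}(F)=(\mathrm{ID}(F)-1)\,\mathrm{IV}(F). \]
   Context: $\tau_1,\tau_2,\tau_3$ are the real embeddings of $K$, $\iota_M:K\to\mathbb{R}^3$, $\alpha\mapsto(\tau_1(\alpha),\tau_2(\alpha),\tau_3(\alpha))$, $\Lambda=\iota_M(\mathcal{O}_K)$. $\mathcal{O}_K^+$ is the set of totally positive elements of $\mathcal{O}_K$; $\alpha\in\mathcal{O}_K^+$ is indecomposable if it is not a sum of two elements of $\mathcal{O}_K^+$. The sail $\mathcal{S}_K$ is the boundary of $\operatorname{Conv}(\Lambda\cap\mathbb{R}_{>0}^3)$. The integer volume of an integer simplex $S=\langle v_0,\dots,v_d\rangle$ (vertices in $\Lambda$) is the index of the subgroup generated by $v_1-v_0,\dots,v_d-v_0$ in $\Lambda\cap\operatorname{Span}_{\mathbb{R}}(v_1-v_0,\dots,v_d-v_0)$; $\mathrm{IV}$ of an integer polytope is the sum over a decomposition into integer simplices of the same dimension. For an integer polytope $S$ whose affine hull $A$ does not contain $0$, $\mathrm{ID}(S)$ is the index of the subgroup generated by $A\cap\Lambda$ in $\Lambda\cap\operatorname{Span}_{\mathbb{R}}(A)$. $\iota_{\mathrm{int}}(F)$ is the number of indecomposable $\alpha\in\mathcal{O}_K^+$ with $\iota_M(\alpha)\in\{tx:t>0,x\in F\}\setminus F$. *)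

theory Defs
  imports "HOL-Analysis.Analysis" "HOL-Computational_Algebra.Polynomial"
begin

text \<open>The field K is modelled as a type 'k of characteristic 0 which has
  dimension 3 as a vector space over Q (i.e. [K:Q] = 3).\<close>
definition degree_three_over_Q :: "('k::field_char_0) itself \<Rightarrow> bool" where
  "degree_three_over_Q _ \<longleftrightarrow>
     (\<exists>b1 b2 b3 :: 'k. \<forall>x :: 'k. \<exists>!c :: rat \<times> rat \<times> rat.
        x = of_rat (fst c) * b1 + of_rat (fst (snd c)) * b2 + of_rat (snd (snd c)) * b3)"

definition real_embedding :: "('k::field_char_0 \<Rightarrow> real) \<Rightarrow> bool" where
  "real_embedding \<tau> \<longleftrightarrow>
     \<tau> 1 = 1 \<and> (\<forall>x y. \<tau> (x + y) = \<tau> x + \<tau> y) \<and> (\<forall>x y. \<tau> (x * y) = \<tau> x * \<tau> y)"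

definition iota_M :: "('k \<Rightarrow> real) \<Rightarrow> ('k \<Rightarrow> real) \<Rightarrow> ('k \<Rightarrow> real) \<Rightarrow> 'k \<Rightarrow> real^3" where
  "iota_M \<tau>1 \<tau>2 \<tau>3 x = vector [\<tau>1 x, \<tau>2 x, \<tau>3 x]"

definition ring_of_integers :: "('k::field_char_0) set" where
  "ring_of_integers = {x. algebraic_int x}"

definition Lambda :: "('k::field_char_0 \<Rightarrow> real) \<Rightarrow> ('k \<Rightarrow> real) \<Rightarrow> ('k \<Rightarrow> real) \<Rightarrow> (real^3) set" where
  "Lambda \<tau>1 \<tau>2 \<tau>3 = iota_M \<tau>1 \<tau>2 \<tau>3 ` ring_of_integers"

definition totally_positive :: "('k::field_char_0 \<Rightarrow> real) \<Rightarrow> ('k \<Rightarrow> real) \<Rightarrow> ('k \<Rightarrow> real) \<Rightarrow> 'k set" where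
  "totally_positive \<tau>1 \<tau>2 \<tau>3 =
     {x \<in> ring_of_integers. \<tau>1 x > 0 \<and> \<tau>2 x > 0 \<and> \<tau>3 x > 0}"

definition indecomposable :: "('k::field_char_0 \<Rightarrow> real) \<Rightarrow> ('k \<Rightarrow> real) \<Rightarrow> ('k \<Rightarrow> real) \<Rightarrow> 'k \<Rightarrow> bool" where
  "indecomposable \<tau>1 \<tau>2 \<tau>3 a \<longleftrightarrow>
     a \<in> totally_positive \<tau>1 \<tau>2 \<tau>3 \<and>
     \<not> (\<exists>b c. b \<in> totally_positive \<tau>1 \<tau>2 \<tau>3 \<and> c \<in> totally_positive \<tau>1 \<tau>2 \<tau>3 \<and> a = b + c)"

definition positive_octant :: "(real^3) set" where
  "positive_octant = {x. \<forall>i. x $ i > 0}"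

definition klein_polyhedron :: "(real^3) set \<Rightarrow> (real^3) set" where
  "klein_polyhedron L = convex hull (L \<inter> positive_octant)"

definition sail :: "(real^3) set \<Rightarrow> (real^3) set" where
  "sail L = frontier (klein_polyhedron L)"

definition sail_face_2 :: "(real^3) set \<Rightarrow> (real^3) set \<Rightarrow> bool" where
  "sail_face_2 L F \<longleftrightarrow> F face_of klein_polyhedron L \<and> aff_dim F = 2 \<and> F \<subseteq> sail L"

definition zspan :: "'a::real_vector set \<Rightarrow> 'a set" where
  "zspan S = {x. \<exists>T c. finite T \<and> T \<subseteq> S \<and> (\<forall>v\<in>T. c v \<in> \<int>) \<and> x = (\<Sum>v\<in>T. c v *\<^sub>R v)}"

definition group_index :: "'a::real_vector set \<Rightarrow> 'a set \<Rightarrow> nat" where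
  "group_index G H = card ((\<lambda>x. {y \<in> G. y - x \<in> H}) ` G)"

fun simplex_IV :: "(real^3) set \<Rightarrow> (real^3) list \<Rightarrow> nat" where
  "simplex_IV L [] = 0"
| "simplex_IV L (v0 # vs) =
     group_index (L \<inter> span ((\<lambda>v. v - v0) ` set vs)) (zspan ((\<lambda>v. v - v0) ` set vs))"

definition integer_decomposition :: "(real^3) set \<Rightarrow> nat \<Rightarrow> (real^3) set \<Rightarrow> (real^3) list set \<Rightarrow> bool" where
  "integer_decomposition L d P T \<longleftrightarrow>
     finite T \<and>
     (\<forall>s\<in>T. length s = d + 1 \<and> distinct s \<and> set s \<subseteq> L \<and> \<not> affine_dependent (set s)) \<and>
     \<Union> ((\<lambda>s. convex hull (set s)) ` T) = P \<and>
     (\<forall>s\<in>T. \<forall>t\<in>T. s \<noteq> t \<longrightarrow>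
        rel_interior (convex hull (set s)) \<inter> rel_interior (convex hull (set t)) = {})"

definition IV :: "(real^3) set \<Rightarrow> (real^3) set \<Rightarrow> nat" where
  "IV L P = (SOME n. \<exists>T. integer_decomposition L (nat (aff_dim P)) P T \<and> n = (\<Sum>s\<in>T. simplex_IV L s))"

definition ID :: "(real^3) set \<Rightarrow> (real^3) set \<Rightarrow> nat" where
  "ID L S = group_index (L \<inter> span (affine hull S)) (zspan (affine hull S \<inter> L))"

definition iota_int :: "('k::field_char_0 \<Rightarrow> real) \<Rightarrow> ('k \<Rightarrow> real) \<Rightarrow> ('k \<Rightarrow> real) \<Rightarrow> (real^3) set \<Rightarrow> nat" where
  "iota_int \<tau>1 \<tau>2 \<tau>3 F =
     card {a. indecomposable \<tau>1 \<tau>2 \<tau>3 a \<and>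
              iota_M \<tau>1 \<tau>2 \<tau>3 a \<in> {t *\<^sub>R x | t x. t > 0 \<and> x \<in> F} - F}"

end

theory Submission
  imports Defs "Jordan_Normal_Form.Char_Poly"
begin

text \<open>
  Let \<open>a\<close> be the linear functional with value 1 on the plane of \<open>F\<close>; every totally positive integer has level
  \<open>a \<bullet> x \<ge> 1\<close>. The coordinates of \<open>a\<close> are positive: they are nonnegative because the rational multiples of \<open>\<Lambda>\<close>
  are dense, and a zero coordinate would make two conjugates of a quotient of lattice vectors equal, hence the
  quotient rational and the face at most one-dimensional. So \<open>F\<close> is a lattice polygon and can be triangulated.

  For a lattice triangle \<open>v0, v1, v2\<close> in \<open>F\<close>, the half-open parallelepiped spanned by the \<open>vi\<close> contains
  \<open>ID \<cdot> IV\<close> lattice points, of which \<open>IV\<close> have integral level. Reflecting \<open>x\<close> to \<open>v0 + v1 + v2 - x\<close> shows that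
  a lattice point of non-integral level there lies strictly between the levels 1 and 2 and in the interior of the
  cone, so it is indecomposable and belongs to one triangle only. Conversely, an indecomposable in the cone but
  not in \<open>F\<close> has all coefficients below 1, and its level cannot be 2 because a lattice point in the double of a
  lattice triangle is a sum of two lattice points of the triangle.
\<close>

section \<open>Algebraic integers\<close>

text \<open>The formula is an index computation. Let \<open>M\<close> be the group generated by the
  vertices of one triangle and \<open>L_int\<close> the group of lattice points of integral level,
  so that \<open>M\<close> lies in \<open>L_int\<close> and \<open>L_int\<close> in
  \<open>L\<close>. The box is a fundamental domain for \<open>M\<close>. The points of level 1
  generate exactly \<open>L_int\<close>, so ID is the index of \<open>L_int\<close> in
  \<open>L\<close>; splitting off \<open>v0\<close> shows that the IV of the triangle is the index
  of \<open>M\<close> in \<open>L_int\<close>. The product counts all box points, and removing those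
  of integral level leaves the factor ID - 1.

  \<open>IV\<close> picks the value of some decomposition, so the count is made for an arbitrary
  one, and the existence of a decomposition is what gives the choice a meaning.

  The Klein polyhedron is the hull of an infinite set. That a face has finitely many lattice
  generators rests on the strict positivity of \<open>a\<close>, which bounds the part of the plane
  inside the octant, and on the discreteness of the lattice, which comes from norms of nonzero
  integers being at least 1 in absolute value. This needs the ring structure of the algebraic
  integers, hence the first section.\<close>

lemma algebraic_int_if_int_matrix:
  fixes z :: "'a :: field_char_0" and w :: "nat \<Rightarrow> 'a" and a :: "nat \<Rightarrow> nat \<Rightarrow> int"
  assumes eq: "\<And>i. i < n \<Longrightarrow> z * w i = (\<Sum>j<n. of_int (a i j) * w j)"
    and k: "k < n" "w k \<noteq> 0"
  shows "algebraic_int z"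
proof -
  define A where "A = mat n n (\<lambda>(i, j). a i j)"
  define v where "v = Matrix.vec n w"
  have A: "A \<in> carrier_mat n n" by (simp add: A_def)
  let ?A = "of_int_hom.mat_hom A :: 'a mat"
  have A': "?A \<in> carrier_mat n n" using A by simp
  \<comment> \<open>The relations say that \<open>w\<close> is an eigenvector of an integer matrix
    with eigenvalue \<open>z\<close>; the characteristic polynomial is monic with integer
    coefficients.\<close>
  have "eigenvector ?A v z"
    unfolding eigenvector_def
  proof (intro conjI)
    show "v \<in> carrier_vec (dim_row ?A)" by (simp add: v_def A_def)
    show "v \<noteq> 0\<^sub>v (dim_row ?A)"
    proof
      assume "v = 0\<^sub>v (dim_row ?A)"
      hence "vec_index v k = vec_index (0\<^sub>v (dim_row ?A)) k" by simp
      thus False using k by (simp add: v_def A_def)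
    qed
    show "?A *\<^sub>v v = z \<cdot>\<^sub>v v"
    proof (rule eq_vecI)
      fix i assume "i < dim_vec (z \<cdot>\<^sub>v v)"
      hence i: "i < n" by (simp add: v_def)
      thus "vec_index (?A *\<^sub>v v) i = vec_index (z \<cdot>\<^sub>v v) i"
        using eq[OF i]
        by (simp add: v_def A_def scalar_prod_def atLeast0LessThan)
    qed (simp add: A_def v_def)
  qed
  hence "eigenvalue ?A z" unfolding eigenvalue_def by blast
  hence "poly (char_poly ?A) z = 0" using eigenvalue_root_char_poly[OF A'] by simp
  moreover have "char_poly ?A = map_poly of_int (char_poly A)"
    by (rule of_int_hom.char_poly_hom[OF A])
  moreover have "lead_coeff (char_poly A) = 1"
    using degree_monic_char_poly[OF A] by simp
  ultimately show ?thesis unfolding algebraic_int_altdef_ipoly by auto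
qed

text \<open>The products \<open>x ^ i * y ^ j\<close> with exponents below the degrees of monic
  equations for \<open>x\<close> and \<open>y\<close> generate a module \<open>W\<close> over the
  integers that is stable under multiplication by \<open>x\<close> and by \<open>y\<close>. So
  \<open>x + y\<close> and \<open>x * y\<close> both act on these generators by integer
  matrices.\<close>

lemma algebraic_int_closed:
  fixes x y :: "'a :: field_char_0"
  assumes x: "algebraic_int x" and y: "algebraic_int y"
  shows "algebraic_int (x + y)" and "algebraic_int (x * y)"
proof -
  have red: "\<exists>m c. 0 < m \<and> z ^ m = (\<Sum>i<m. of_int (c i) * z ^ i)" if "algebraic_int z" for z :: 'a
  proof -
    from that obtain p where p: "lead_coeff p = 1" "poly (map_poly of_int p :: 'a poly) z = 0"
      unfolding algebraic_int_altdef_ipoly by blast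
    let ?m = "degree p"
    have d: "degree (map_poly of_int p :: 'a poly) = ?m" by (rule degree_map_poly) auto
    \<comment> \<open>Positive degrees keep the generator \<open>x ^ 0 * y ^ 0 = 1\<close> in the
      list.\<close>
    have "0 < ?m"
    proof (rule ccontr)
      assume "\<not> 0 < ?m"
      then obtain c where "p = [:c:]" using degree_eq_zeroE by blast
      with p(1) have "p = 1" by simp
      thus False using p(2) by simp
    qed
    moreover have "z ^ ?m = (\<Sum>i<?m. of_int (- coeff p i) * z ^ i)"
    proof -
      have "0 = (\<Sum>i\<le>?m. of_int (coeff p i) * z ^ i)"
        using p(2) by (simp add: poly_altdef d coeff_map_poly)
      also have "\<dots> = (\<Sum>i<?m. of_int (coeff p i) * z ^ i) + z ^ ?m"
        using p(1) by (simp add: lessThan_Suc_atMost[symmetric])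
      finally show ?thesis by (simp add: sum_negf eq_neg_iff_add_eq_0 add.commute)
    qed
    ultimately show ?thesis by (intro exI[of _ ?m] exI[of _ "\<lambda>i. - coeff p i"]) auto
  qed
  obtain m c where m: "0 < m" "x ^ m = (\<Sum>i<m. of_int (c i) * x ^ i)" using red[OF x] by blast
  obtain n d where n: "0 < n" "y ^ n = (\<Sum>i<n. of_int (d i) * y ^ i)" using red[OF y] by blast
  define W where "W = {u. \<exists>a :: nat \<times> nat \<Rightarrow> int. u = (\<Sum>(i,j)\<in>{..<m}\<times>{..<n}. of_int (a (i,j)) * (x ^ i * y ^ j))}"
  have W_add: "u + v \<in> W" if "u \<in> W" "v \<in> W" for u v
  proof -
    from that obtain a b where "u = (\<Sum>(i,j)\<in>{..<m}\<times>{..<n}. of_int (a (i,j)) * (x ^ i * y ^ j))"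
      "v = (\<Sum>(i,j)\<in>{..<m}\<times>{..<n}. of_int (b (i,j)) * (x ^ i * y ^ j))" unfolding W_def by blast
    thus ?thesis unfolding W_def
      by (auto intro!: exI[of _ "\<lambda>p. a p + b p"] simp: sum.distrib[symmetric] algebra_simps case_prod_unfold)
  qed
  have W_mult: "of_int k * u \<in> W" if "u \<in> W" for u k
  proof -
    from that obtain a where "u = (\<Sum>(i,j)\<in>{..<m}\<times>{..<n}. of_int (a (i,j)) * (x ^ i * y ^ j))"
      unfolding W_def by blast
    thus ?thesis unfolding W_def
      by (auto intro!: exI[of _ "\<lambda>p. k * a p"] simp: sum_distrib_left algebra_simps case_prod_unfold)
  qed
  have W_0: "0 \<in> W" unfolding W_def by (auto intro!: exI[of _ "\<lambda>_. 0"])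
  have W_sum: "(\<Sum>i\<in>I. f i) \<in> W" if "\<And>i. i \<in> I \<Longrightarrow> f i \<in> W" for f and I :: "nat set"
    using that by (induction I rule: infinite_finite_induct) (auto intro: W_add W_0)
  have W_gen: "x ^ i * y ^ j \<in> W" if "i < m" "j < n" for i j
  proof -
    have "(\<Sum>p\<in>{..<m}\<times>{..<n}. of_int (if p = (i,j) then 1 else 0) * (x ^ fst p * y ^ snd p))
        = (\<Sum>p\<in>{..<m}\<times>{..<n}. if p = (i,j) then x ^ i * y ^ j else 0)"
      by (rule sum.cong) auto
    also have "\<dots> = x ^ i * y ^ j" using that by simp
    finally show ?thesis unfolding W_def
      by (auto intro!: exI[of _ "\<lambda>p. if p = (i,j) then 1 else 0"] simp: case_prod_unfold)
  qed
  have W_x: "x * (x ^ i * y ^ j) \<in> W" if "i < m" "j < n" for i j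
  proof (cases "Suc i < m")
    case True
    thus ?thesis using W_gen[of "Suc i" j] that by (simp add: mult.assoc)
  next
    case False
    hence "x * (x ^ i * y ^ j) = x ^ m * y ^ j" using that
      by (metis Suc_lessI mult.assoc power_Suc)
    also have "\<dots> = (\<Sum>k<m. of_int (c k) * (x ^ k * y ^ j))"
      by (simp add: m(2) sum_distrib_right mult.assoc)
    finally show ?thesis using that by (auto intro!: W_sum W_mult W_gen)
  qed
  have W_y: "y * (x ^ i * y ^ j) \<in> W" if "i < m" "j < n" for i j
  proof (cases "Suc j < n")
    case True
    thus ?thesis using W_gen[of i "Suc j"] that by (simp add: mult.left_commute)
  next
    case False
    hence "y * (x ^ i * y ^ j) = x ^ i * y ^ n" using that
      by (metis Suc_lessI mult.left_commute power_Suc)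
    also have "\<dots> = (\<Sum>k<n. of_int (d k) * (x ^ i * y ^ k))"
      by (simp add: n(2) sum_distrib_left mult.left_commute)
    finally show ?thesis using that by (auto intro!: W_sum W_mult W_gen)
  qed
  have W_mul: "z * u \<in> W" if z: "\<And>i j. i < m \<Longrightarrow> j < n \<Longrightarrow> z * (x ^ i * y ^ j) \<in> W" and u: "u \<in> W" for z u
  proof -
    from u obtain a where u: "u = (\<Sum>(i,j)\<in>{..<m}\<times>{..<n}. of_int (a (i,j)) * (x ^ i * y ^ j))"
      unfolding W_def by blast
    have "z * u = (\<Sum>i<m. \<Sum>j<n. of_int (a (i,j)) * (z * (x ^ i * y ^ j)))"
      by (simp add: u sum.cartesian_product[symmetric] sum_distrib_left mult.left_commute)
    thus ?thesis by (auto intro!: W_sum W_mult z)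
  qed
  have main: "algebraic_int z" if z: "\<And>i j. i < m \<Longrightarrow> j < n \<Longrightarrow> z * (x ^ i * y ^ j) \<in> W" for z
  proof -
    \<comment> \<open>Row-major numbering of the generators by naturals, as the matrix criterion
      expects; generator 0 is 1 and serves as the required nonzero entry.\<close>
    let ?w = "\<lambda>k. x ^ (k div n) * y ^ (k mod n)"
    have "\<exists>b :: nat \<Rightarrow> int. z * ?w k = (\<Sum>j<m*n. of_int (b j) * ?w j)" if "k < m * n" for k
    proof -
      have "k div n < m" "k mod n < n" using that n(1) by (simp_all add: less_mult_imp_div_less)
      from z[OF this] obtain a where
        a: "z * ?w k = (\<Sum>(i,j)\<in>{..<m}\<times>{..<n}. of_int (a (i,j)) * (x ^ i * y ^ j))"
        unfolding W_def by blast
      have bd: "i * n + j < m * n" if "i < m" "j < n" for i j :: nat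
      proof -
        have "Suc i * n \<le> m * n" using that by (intro mult_le_mono1) simp
        thus ?thesis using that by simp
      qed
      note a
      also have "(\<Sum>(i,j)\<in>{..<m}\<times>{..<n}. of_int (a (i,j)) * (x ^ i * y ^ j)) = (\<Sum>j<m*n. of_int (a (j div n, j mod n)) * ?w j)"
        using n(1)
        by (intro sum.reindex_bij_witness[of _ "\<lambda>k. (k div n, k mod n)" "\<lambda>(i,j). i * n + j"])
           (auto simp: less_mult_imp_div_less intro: bd)
      finally show ?thesis by (intro exI[of _ "\<lambda>j. a (j div n, j mod n)"])
    qed
    hence "\<forall>k. \<exists>b :: nat \<Rightarrow> int. k < m * n \<longrightarrow> z * ?w k = (\<Sum>j<m*n. of_int (b j) * ?w j)"
      by blast
    from choice[OF this] obtain b :: "nat \<Rightarrow> nat \<Rightarrow> int"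
      where "\<And>k. k < m * n \<Longrightarrow> z * ?w k = (\<Sum>j<m*n. of_int (b k j) * ?w j)" by blast
    thus ?thesis using m(1) n(1) by (intro algebraic_int_if_int_matrix[of "m*n" z ?w b 0]) auto
  qed
  show "algebraic_int (x + y)"
    by (rule main) (auto simp: distrib_right intro!: W_add W_x W_y)
  show "algebraic_int (x * y)"
    by (rule main) (auto simp: mult.assoc intro!: W_mul W_x W_y)
qed

section \<open>Totally real cubic fields\<close>

hide_const (open) Matrix.mat Matrix.vec Determinant.det
hide_fact (open) Matrix.vec_eq_iff
no_notation vec_index (infixl \<open>$\<close> 100) and scalar_prod (infix \<open>\<bullet>\<close> 70)

context
  fixes \<tau> :: "'k::field_char_0 \<Rightarrow> real"
  assumes \<tau>: "real_embedding \<tau>"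
begin

lemma real_embedding_hom:
  "\<tau> 1 = 1" "\<tau> (x + y) = \<tau> x + \<tau> y" "\<tau> (x * y) = \<tau> x * \<tau> y"
  using \<tau> unfolding real_embedding_def by blast+

lemma real_embedding_0: "\<tau> 0 = 0"
  using real_embedding_hom(2)[of 0 0] by simp

lemma real_embedding_uminus: "\<tau> (- x) = - \<tau> x"
  using real_embedding_hom(2)[of x "- x"] real_embedding_0 by simp

lemma real_embedding_diff: "\<tau> (x - y) = \<tau> x - \<tau> y"
  using real_embedding_hom(2)[of x "- y"] real_embedding_uminus by simp

lemma real_embedding_eq_0_iff: "\<tau> x = 0 \<longleftrightarrow> x = 0"
proof
  assume "\<tau> x = 0"
  thus "x = 0" using real_embedding_hom(3)[of x "inverse x"] real_embedding_hom(1)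
    by (cases "x = 0") auto
qed (simp add: real_embedding_0)

lemma real_embedding_eq_iff: "\<tau> x = \<tau> y \<longleftrightarrow> x = y"
  using real_embedding_eq_0_iff[of "x - y"] by (simp add: real_embedding_diff)

lemma real_embedding_of_nat: "\<tau> (of_nat n) = of_nat n"
  by (induction n) (simp_all add: real_embedding_0 real_embedding_hom)

lemma real_embedding_of_int: "\<tau> (of_int n) = of_int n"
  by (cases n rule: int_diff_cases) (simp add: real_embedding_diff real_embedding_of_nat)

lemma real_embedding_of_rat: "\<tau> (of_rat q) = of_rat q"
proof (cases q)
  case (Fract a b)
  have "(of_rat q :: 'k) * of_int b = of_int a"
    using Fract by (simp add: of_rat_rat)
  hence "\<tau> (of_rat q) * of_int b = of_int a"
    by (metis real_embedding_hom(3) real_embedding_of_int)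
  thus ?thesis using Fract by (simp add: of_rat_rat field_simps)
qed

lemma real_embedding_power: "\<tau> (x ^ n) = \<tau> x ^ n"
  by (induction n) (simp_all add: real_embedding_hom)

lemma real_embedding_sum: "\<tau> (\<Sum>i\<in>I. f i) = (\<Sum>i\<in>I. \<tau> (f i))"
  by (induction I rule: infinite_finite_induct) (simp_all add: real_embedding_0 real_embedding_hom)

lemma real_embedding_algebraic_int:
  assumes "algebraic_int x"
  shows "algebraic_int (\<tau> x)"
proof -
  from assms obtain p where p: "lead_coeff p = 1" "poly (map_poly of_int p) x = 0"
    unfolding algebraic_int_altdef_ipoly by blast
  have "poly (map_poly of_int p) (\<tau> x) = \<tau> (poly (map_poly of_int p) x)"
    by (simp add: poly_altdef degree_map_poly coeff_map_poly real_embedding_sum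
        real_embedding_hom real_embedding_of_int real_embedding_power)
  hence "poly (map_poly of_int p) (\<tau> x) = 0" using p real_embedding_0 by simp
  thus ?thesis using p unfolding algebraic_int_altdef_ipoly by blast
qed

end

text \<open>Dedekind's argument: substituting \<open>x y\<close> for \<open>x\<close> eliminates one embedding at a time.\<close>

lemma real_embeddings_independent:
  fixes \<tau>1 \<tau>2 \<tau>3 :: "'k::field_char_0 \<Rightarrow> real"
  assumes emb: "real_embedding \<tau>1" "real_embedding \<tau>2" "real_embedding \<tau>3"
    and "\<tau>1 \<noteq> \<tau>2" "\<tau>2 \<noteq> \<tau>3"
    and lin: "\<And>x. v1 * \<tau>1 x + v2 * \<tau>2 x + v3 * \<tau>3 x = 0"
  shows "v2 = 0"
proof -
  obtain y where y: "\<tau>1 y \<noteq> \<tau>2 y" using assms by blast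
  obtain z where z: "\<tau>2 z \<noteq> \<tau>3 z" using assms by blast
  note h = real_embedding_hom[OF emb(1)] real_embedding_hom[OF emb(2)] real_embedding_hom[OF emb(3)]
  have 1: "v2 * (\<tau>2 y - \<tau>1 y) * \<tau>2 x + v3 * (\<tau>3 y - \<tau>1 y) * \<tau>3 x = 0" for x
  proof -
    have "v2 * (\<tau>2 y - \<tau>1 y) * \<tau>2 x + v3 * (\<tau>3 y - \<tau>1 y) * \<tau>3 x
        = (v1 * \<tau>1 (y * x) + v2 * \<tau>2 (y * x) + v3 * \<tau>3 (y * x))
          - \<tau>1 y * (v1 * \<tau>1 x + v2 * \<tau>2 x + v3 * \<tau>3 x)"
      by (simp add: h algebra_simps)
    thus ?thesis by (simp add: lin)
  qed
  have "v2 * (\<tau>2 y - \<tau>1 y) * (\<tau>2 z - \<tau>3 z) = 0"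
  proof -
    have "v2 * (\<tau>2 y - \<tau>1 y) * (\<tau>2 z - \<tau>3 z)
        = (v2 * (\<tau>2 y - \<tau>1 y) * \<tau>2 z + v3 * (\<tau>3 y - \<tau>1 y) * \<tau>3 z)
          - \<tau>3 z * (v2 * (\<tau>2 y - \<tau>1 y) * \<tau>2 1 + v3 * (\<tau>3 y - \<tau>1 y) * \<tau>3 1)"
      by (simp add: h algebra_simps)
    thus ?thesis by (simp add: 1)
  qed
  thus ?thesis using y z by simp
qed

locale totally_real_cubic =
  fixes \<tau>1 \<tau>2 \<tau>3 :: "'k::field_char_0 \<Rightarrow> real"
  assumes deg: "degree_three_over_Q TYPE('k)"
    and emb: "real_embedding \<tau>1" "real_embedding \<tau>2" "real_embedding \<tau>3"
    and dist: "\<tau>1 \<noteq> \<tau>2" "\<tau>1 \<noteq> \<tau>3" "\<tau>2 \<noteq> \<tau>3"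
begin

abbreviation "\<iota> \<equiv> iota_M \<tau>1 \<tau>2 \<tau>3"
abbreviation "L \<equiv> Lambda \<tau>1 \<tau>2 \<tau>3"

lemma iota_nth [simp]: "\<iota> x $ 1 = \<tau>1 x" "\<iota> x $ 2 = \<tau>2 x" "\<iota> x $ 3 = \<tau>3 x"
  by (simp_all add: iota_M_def)

lemmas hom = real_embedding_hom[OF emb(1)] real_embedding_hom[OF emb(2)] real_embedding_hom[OF emb(3)]

lemma iota_add: "\<iota> (x + y) = \<iota> x + \<iota> y"
  by (simp add: vec_eq_iff forall_3 hom)

lemma iota_uminus: "\<iota> (- x) = - \<iota> x"
  by (simp add: vec_eq_iff forall_3 emb real_embedding_uminus)

lemma iota_0: "\<iota> 0 = 0"
  by (simp add: vec_eq_iff forall_3 emb real_embedding_0)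

lemma iota_of_rat_mult: "\<iota> (of_rat q * x) = of_rat q *\<^sub>R \<iota> x"
  by (simp add: vec_eq_iff forall_3 emb hom real_embedding_of_rat)

lemma iota_eq_iff: "\<iota> x = \<iota> y \<longleftrightarrow> x = y"
  by (auto simp: vec_eq_iff forall_3 emb real_embedding_eq_iff)

lemma zero_in_L: "0 \<in> L"
  unfolding Lambda_def ring_of_integers_def using iota_0 by (metis algebraic_int_0 imageI mem_Collect_eq)

lemma add_in_L: "x \<in> L \<Longrightarrow> y \<in> L \<Longrightarrow> x + y \<in> L"
  unfolding Lambda_def ring_of_integers_def
  by (auto simp: iota_add[symmetric] intro!: imageI algebraic_int_closed)

lemma uminus_in_L: "x \<in> L \<Longrightarrow> - x \<in> L"
  unfolding Lambda_def ring_of_integers_def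
  by (auto simp: iota_uminus[symmetric] intro!: imageI)

lemma one_in_L: "1 \<in> L"
proof -
  have "\<iota> 1 = 1" by (simp add: vec_eq_iff forall_3 hom)
  thus ?thesis unfolding Lambda_def ring_of_integers_def
    by (metis algebraic_int_closed(1) imageI int_imp_algebraic_int Ints_1 mem_Collect_eq)
qed

text \<open>A kernel vector of the matrix is a real linear relation between the three embeddings on
  the basis, hence on all of the field, and distinct embeddings are linearly independent.\<close>

lemma rational_basis:
  "\<exists>b :: 3 \<Rightarrow> 'k. (\<forall>x. \<exists>c. x = (\<Sum>j\<in>UNIV. of_rat (c j) * b j)) \<and>
     det (\<chi> i j. \<iota> (b i) $ j) \<noteq> 0"
proof -
  obtain b1 b2 b3 :: 'k where b: "\<forall>x :: 'k. \<exists>!c :: rat \<times> rat \<times> rat.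
        x = of_rat (fst c) * b1 + of_rat (fst (snd c)) * b2 + of_rat (snd (snd c)) * b3"
    using deg unfolding degree_three_over_Q_def by blast
  define b where "b = (\<lambda>i :: 3. if i = 1 then b1 else if i = 2 then b2 else b3)"
  have rep: "\<exists>c. x = (\<Sum>j\<in>UNIV. of_rat (c j) * b j)" for x
  proof -
    obtain c where "x = of_rat (fst c) * b1 + of_rat (fst (snd c)) * b2 + of_rat (snd (snd c)) * b3"
      using b by blast
    thus ?thesis
      by (intro exI[of _ "\<lambda>i :: 3. if i = 1 then fst c else if i = 2 then fst (snd c) else snd (snd c)"])
         (simp add: sum_3 b_def)
  qed
  let ?B = "\<chi> i j. \<iota> (b i) $ j"
  have "det ?B \<noteq> 0"
  proof
    assume "det ?B = 0"
    hence "\<not> invertible ?B" by (simp add: invertible_det_nz)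
    then obtain v where v: "?B *v v = 0" "v \<noteq> 0"
      by (metis invertible_left_inverse matrix_left_invertible_ker)
    have "(\<Sum>j\<in>UNIV. v $ j * \<iota> (b i) $ j) = 0" for i
      using v(1) by (simp add: vec_eq_iff matrix_vector_mult_def mult.commute)
    hence vb: "v $ 1 * \<tau>1 (b i) + v $ 2 * \<tau>2 (b i) + v $ 3 * \<tau>3 (b i) = 0" for i
      by (simp add: sum_3)
    have lin: "v $ 1 * \<tau>1 x + v $ 2 * \<tau>2 x + v $ 3 * \<tau>3 x = 0" for x
    proof -
      obtain c where x: "x = (\<Sum>j\<in>UNIV. of_rat (c j) * b j)" using rep by blast
      have "v $ 1 * \<tau>1 x + v $ 2 * \<tau>2 x + v $ 3 * \<tau>3 x =
        (\<Sum>i\<in>UNIV. of_rat (c i) * (v $ 1 * \<tau>1 (b i) + v $ 2 * \<tau>2 (b i) + v $ 3 * \<tau>3 (b i)))"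
        by (simp add: x sum_3 emb hom real_embedding_of_rat algebra_simps)
      thus ?thesis by (simp add: vb)
    qed
    \<comment> \<open>The independence lemma kills the middle coefficient only, so it is applied to
      three orderings of the embeddings.\<close>
    have "v $ 2 = 0" using real_embeddings_independent[OF emb dist(1,3) lin] .
    moreover have "v $ 1 = 0"
      using real_embeddings_independent[OF emb(2,1,3) _ dist(2), of "v$2" "v$1" "v$3"] lin dist
      by (auto simp: add_ac)
    moreover have "v $ 3 = 0"
      using real_embeddings_independent[OF emb(1,3,2) dist(2), of "v$1" "v$3" "v$2"] lin dist
      by (auto simp: add_ac)
    ultimately show False using v(2) by (simp add: vec_eq_iff forall_3)
  qed
  thus ?thesis using rep by blast
qed

text \<open>Multiplication by \<open>x\<close> has a rational matrix \<open>M\<close> in the basis,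
  and the matrix of conjugates of the basis diagonalises it with the conjugates of \<open>x\<close>
  as eigenvalues. Their product is \<open>det M\<close>.\<close>

lemma norm_rational: "\<tau>1 x * \<tau>2 x * \<tau>3 x \<in> \<rat>"
proof -
  from rational_basis obtain b :: "3 \<Rightarrow> 'k"
    where B: "(\<forall>x. \<exists>c. x = (\<Sum>j\<in>UNIV. of_rat (c j) * b j)) \<and>
      det (\<chi> i j. \<iota> (b i) $ j) \<noteq> 0" ..
  note b = spec[OF conjunct1[OF B]] and nz = conjunct2[OF B]
  have "\<forall>i. \<exists>c. x * b i = (\<Sum>j\<in>UNIV. of_rat (c j) * b j)" using b by blast
  from choice[OF this] obtain c where c: "\<And>i. x * b i = (\<Sum>j\<in>UNIV. of_rat (c i j) * b j)" by blast
  define M :: "real^3^3" where "M = (\<chi> i j. of_rat (c i j))"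
  let ?B = "(\<chi> i j. \<iota> (b i) $ j) :: real^3^3"
  have t: "\<tau>1 x * \<tau>1 (b i) = (\<Sum>j\<in>UNIV. of_rat (c i j) * \<tau>1 (b j))"
          "\<tau>2 x * \<tau>2 (b i) = (\<Sum>j\<in>UNIV. of_rat (c i j) * \<tau>2 (b j))"
          "\<tau>3 x * \<tau>3 (b i) = (\<Sum>j\<in>UNIV. of_rat (c i j) * \<tau>3 (b j))" for i
    using arg_cong[OF c[of i], of \<tau>1] arg_cong[OF c[of i], of \<tau>2] arg_cong[OF c[of i], of \<tau>3]
    by (simp_all add: sum_3 emb hom real_embedding_of_rat)
  have "M ** ?B = (\<chi> i j. \<iota> x $ j * \<iota> (b i) $ j)"
    by (simp add: vec_eq_iff forall_3 matrix_matrix_mult_def M_def t)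
  hence "det M * det ?B = det (\<chi> i j. \<iota> x $ j * \<iota> (b i) $ j)"
    by (simp only: det_mul[symmetric])
  also have "\<dots> = (\<tau>1 x * \<tau>2 x * \<tau>3 x) * det ?B"
    by (simp add: det_3 algebra_simps)
  finally have "\<tau>1 x * \<tau>2 x * \<tau>3 x = det M" using nz by simp
  also have "\<dots> \<in> \<rat>" by (simp add: det_3 M_def)
  finally show ?thesis .
qed

text \<open>A rational algebraic integer is an integer, and the norm of a nonzero element is
  nonzero. This bound is the source of discreteness.\<close>

lemma norm_ge_1:
  assumes "x \<in> L" "x \<noteq> 0"
  shows "\<bar>x $ 1 * x $ 2 * x $ 3\<bar> \<ge> 1"
proof -
  obtain a where a: "algebraic_int a" "x = \<iota> a"
    using assms unfolding Lambda_def ring_of_integers_def by blast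
  have "a \<noteq> 0" using a(2) assms(2) iota_0 by metis
  have "algebraic_int (\<tau>1 a * \<tau>2 a * \<tau>3 a)"
    using real_embedding_algebraic_int[OF emb(1) a(1)] real_embedding_algebraic_int[OF emb(2) a(1)]
      real_embedding_algebraic_int[OF emb(3) a(1)] by (metis algebraic_int_closed(2))
  hence "\<tau>1 a * \<tau>2 a * \<tau>3 a \<in> \<int>"
    using norm_rational rational_algebraic_int_is_int by blast
  then obtain k where k: "\<tau>1 a * \<tau>2 a * \<tau>3 a = of_int k" by (rule Ints_cases)
  moreover have "\<tau>1 a * \<tau>2 a * \<tau>3 a \<noteq> 0"
    using \<open>a \<noteq> 0\<close> emb by (simp add: real_embedding_eq_0_iff)
  ultimately show ?thesis using a(2) by auto
qed

text \<open>Clearing the denominators in the matrix of multiplication by \<open>x\<close> gives a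
  multiple \<open>n x\<close> that acts by an integer matrix, hence an algebraic integer. Scaling
  each vector of a rational basis in this way puts it into the lattice.\<close>

lemma spanning_in_L:
  obtains w :: "3 \<Rightarrow> real^3" where "\<And>i. w i \<in> L" "\<And>x. \<exists>c. x = (\<Sum>i\<in>UNIV. c i *\<^sub>R w i)"
proof -
  from rational_basis obtain b :: "3 \<Rightarrow> 'k"
    where B: "(\<forall>x. \<exists>c. x = (\<Sum>j\<in>UNIV. of_rat (c j) * b j)) \<and>
      det (\<chi> i j. \<iota> (b i) $ j) \<noteq> 0" ..
  note b = spec[OF conjunct1[OF B]] and nz = conjunct2[OF B]
  have b_nz: "\<exists>i. b i \<noteq> 0" 
  proof (rule ccontr)
    assume "\<not> ?thesis"
    thus False using b[of 1] by simp
  qed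
  have "\<exists>n::nat. n > 0 \<and> algebraic_int (of_nat n * x)" for x :: 'k
  proof -
    have "\<forall>i. \<exists>c. x * b i = (\<Sum>j\<in>UNIV. of_rat (c j) * b j)" using b by blast
    from choice[OF this] obtain c where c: "\<And>i. x * b i = (\<Sum>j\<in>UNIV. of_rat (c i j) * b j)" by blast
    define d where "d = (\<lambda>i j. nat (snd (quotient_of (c i j))))"
    \<comment> \<open>A common multiple of the denominators of all nine matrix entries.\<close>
    define n where "n = (\<Prod>i\<in>UNIV. \<Prod>j\<in>UNIV. d i j)"
    have d: "d i j > 0" for i j by (simp add: d_def quotient_of_denom_pos')
    have "\<exists>k::int. of_nat n * c i j = of_int k" for i j
    proof -
      have "d i j dvd (\<Prod>j\<in>UNIV. d i j)" by (rule dvd_prodI) auto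
      also have "\<dots> dvd n" unfolding n_def by (rule dvd_prodI) auto
      finally have "d i j dvd n" .
      then obtain e where e: "n = d i j * e" by blast
      have "c i j = of_int (fst (quotient_of (c i j))) / of_int (snd (quotient_of (c i j)))"
        by (metis quotient_of_div surjective_pairing)
      moreover have "of_int (snd (quotient_of (c i j))) = (of_nat (d i j) :: rat)"
        by (simp add: d_def quotient_of_denom_pos' less_imp_le)
      ultimately have "of_nat (d i j) * c i j = of_int (fst (quotient_of (c i j)))"
        using d[of i j] by (simp add: field_simps)
      hence "of_nat n * c i j = of_int (int e * fst (quotient_of (c i j)))"
        by (simp add: e mult_ac)
      thus ?thesis by blast
    qed
    then obtain k :: "3 \<Rightarrow> 3 \<Rightarrow> int" where k: "\<And>i j. of_nat n * c i j = of_int (k i j)" by metis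
    have k': "of_nat n * of_rat (c i j) = (of_int (k i j) :: 'k)" for i j
      using arg_cong[OF k[of i j], of "of_rat :: rat \<Rightarrow> 'k"] by (simp add: of_rat_mult)
    \<comment> \<open>Translates the index type \<open>3\<close> into the naturals below 3 used by
      the matrix criterion.\<close>
    define f where "f = (\<lambda>i::nat. if i = 0 then 1 else if i = 1 then 2 else (3::3))"
    have f: "(\<Sum>j\<in>UNIV. g j) = (\<Sum>j<3. g (f j))" for g :: "3 \<Rightarrow> 'k"
      by (simp add: sum_3 f_def eval_nat_numeral)
    obtain i where "b i \<noteq> 0" using b_nz by blast
    moreover have "i = f 0 \<or> i = f 1 \<or> i = f 2"
      using exhaust_3[of i] by (simp add: f_def)
    moreover have "0 < (3::nat)" "1 < (3::nat)" "2 < (3::nat)" by simp_all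
    ultimately obtain m :: nat where m: "m < 3" "b (f m) \<noteq> 0" by blast
    have "algebraic_int (of_nat n * x)"
    proof (rule algebraic_int_if_int_matrix)
      show "of_nat n * x * b (f i) = (\<Sum>j<3. of_int (k (f i) (f j)) * b (f j))" for i
        by (simp add: mult.assoc c f k'[symmetric] sum_distrib_left)
    qed (use m in auto)
    moreover have "n > 0" using d by (simp add: n_def prod_pos)
    ultimately show ?thesis by blast
  qed
  hence "\<forall>i. \<exists>n::nat. n > 0 \<and> algebraic_int (of_nat n * b i)" by blast
  from choice[OF this] obtain n where n: "\<And>i. n i > 0" "\<And>i. algebraic_int (of_nat (n i) * b i)" by blast
  define w where "w = (\<lambda>i. \<iota> (of_nat (n i) * b i))"
  have w: "w i = real (n i) *\<^sub>R \<iota> (b i)" for i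
    using iota_of_rat_mult[of "of_nat (n i)" "b i"] by (simp add: w_def)
  have "\<exists>c. x = (\<Sum>i\<in>UNIV. c i *\<^sub>R w i)" for x
  proof -
    let ?B = "(\<chi> i j. \<iota> (b i) $ j) :: real^3^3"
    have "invertible (transpose ?B)" using nz by (simp add: invertible_det_nz)
    then obtain B' where "transpose ?B ** B' = mat 1" unfolding invertible_def by blast
    hence "transpose ?B *v (B' *v x) = x" by (simp add: matrix_vector_mul_assoc)
    then obtain c where "transpose ?B *v c = x" by blast
    hence "x = (\<Sum>i\<in>UNIV. (c $ i / real (n i)) *\<^sub>R w i)"
      using n(1) by (auto simp: vec_eq_iff matrix_vector_mult_def transpose_def w mult.commute less_imp_neq[symmetric])
    thus ?thesis by (rule exI[of _ "\<lambda>i. c $ i / real (n i)"])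
  qed
  moreover have "w i \<in> L" for i
    using n(2) by (auto simp: w_def Lambda_def ring_of_integers_def)
  ultimately show ?thesis using that by blast
qed

text \<open>The elementary symmetric functions are read off the norms of \<open>w\<close> and \<open>w \<plusminus> 1\<close>; a double root of a rational
  cubic is rational.\<close>

lemma rational_if_conjugates_eq:
  fixes \<sigma>1 \<sigma>2 \<sigma>3 :: "'k \<Rightarrow> real"
  assumes \<sigma>: "real_embedding \<sigma>1" "real_embedding \<sigma>2" "real_embedding \<sigma>3"
    and norm: "\<And>x. \<sigma>1 x * \<sigma>2 x * \<sigma>3 x \<in> \<rat>"
    and eq: "\<sigma>1 w = \<sigma>2 w"
  shows "\<exists>q. w = of_rat q"
proof -
  define \<alpha> \<beta> where "\<alpha> = \<sigma>3 w" and "\<beta> = \<sigma>1 w"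
  note h = real_embedding_diff real_embedding_hom
  \<comment> \<open>The elementary symmetric functions of the three conjugates \<alpha>, \<beta>,
    \<beta> of \<open>w\<close>.\<close>
  define e1 e2 e3 where "e1 = \<alpha> + 2 * \<beta>" and "e2 = 2 * \<alpha> * \<beta> + \<beta>\<^sup>2" and "e3 = \<alpha> * \<beta>\<^sup>2"
  have e3: "e3 \<in> \<rat>" using norm[of w] eq
    by (simp add: e3_def \<alpha>_def \<beta>_def power2_eq_square mult_ac)
  have "(\<beta> + 1) * (\<beta> + 1) * (\<alpha> + 1) \<in> \<rat>"
    using norm[of "w + 1"] eq \<sigma> by (simp add: real_embedding_hom \<alpha>_def \<beta>_def)
  moreover have "(\<beta> + 1) * (\<beta> + 1) * (\<alpha> + 1) = e3 + e2 + e1 + 1"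
    by (simp add: e1_def e2_def e3_def power2_eq_square algebra_simps)
  ultimately have p: "e2 + e1 \<in> \<rat>" using e3 Rats_diff[of "e3 + e2 + e1 + 1" "e3 + 1"] by (simp add: algebra_simps)
  have "(\<beta> - 1) * (\<beta> - 1) * (\<alpha> - 1) \<in> \<rat>"
    using norm[of "w - 1"] eq \<sigma> by (simp add: h \<alpha>_def \<beta>_def)
  moreover have "(\<beta> - 1) * (\<beta> - 1) * (\<alpha> - 1) = e3 - e2 + e1 - 1"
    by (simp add: e1_def e2_def e3_def power2_eq_square algebra_simps)
  ultimately have "e3 - e2 + e1 - 1 \<in> \<rat>" by simp
  hence "(e3 - e2 + e1 - 1) - (e3 - 1) \<in> \<rat>" using e3 Rats_1 by (blast intro: Rats_diff)
  hence m: "e1 - e2 \<in> \<rat>" by simp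
  have "e1 = ((e2 + e1) + (e1 - e2)) / 2" by simp
  hence e1: "e1 \<in> \<rat>" using p m by (metis Rats_add Rats_divide Rats_number_of)
  have e2: "e2 \<in> \<rat>" using p e1 Rats_diff[of "e2 + e1" e1] by simp
  \<comment> \<open>The quotient of these two rational numbers is twice the double root, unless all
    three conjugates coincide; in that case the root is \<open>e1 / 3\<close>.\<close>
  have disc: "e1\<^sup>2 - 3 * e2 = (\<alpha> - \<beta>)\<^sup>2" "e1 * e2 - 9 * e3 = 2 * \<beta> * (\<alpha> - \<beta>)\<^sup>2"
    by (simp_all add: e1_def e2_def e3_def power2_eq_square algebra_simps)
  have "\<beta> \<in> \<rat>"
  proof (cases "\<alpha> = \<beta>")
    case True
    hence "\<beta> = e1 / 3" by (simp add: e1_def)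
    moreover have "e1 / 3 \<in> \<rat>" using e1 Rats_number_of by (rule Rats_divide)
    ultimately show ?thesis by (simp only:)
  next
    case False
    hence "\<beta> = (e1 * e2 - 9 * e3) / (2 * (e1\<^sup>2 - 3 * e2))" using disc by simp
    thus ?thesis using e1 e2 e3 by simp
  qed
  then obtain q where "\<beta> = of_rat q" by (rule Rats_cases)
  hence "\<sigma>1 w = \<sigma>1 (of_rat q)" using \<sigma>(1) by (simp add: \<beta>_def real_embedding_of_rat)
  thus ?thesis using real_embedding_eq_iff[OF \<sigma>(1)] by blast
qed

text \<open>The hypothesis says that two conjugates of the quotient \<open>x / y\<close> agree, so
  the quotient is rational, and a rational factor acts on the embedded vectors as a scalar.\<close>

lemma proportional_in_L:
  assumes "u \<in> L" "v \<in> L" "v \<noteq> 0" "i \<noteq> j" "u $ i * v $ j = u $ j * v $ i"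
  shows "\<exists>q. u = q *\<^sub>R v"
proof -
  obtain x y where xy: "u = \<iota> x" "v = \<iota> y" using assms unfolding Lambda_def by blast
  have y: "y \<noteq> 0" using assms xy iota_0 by auto
  define w where "w = x / y"
  have x: "x = w * y" using y by (simp add: w_def)
  have "\<tau>1 y \<noteq> 0" "\<tau>2 y \<noteq> 0" "\<tau>3 y \<noteq> 0" using y emb by (simp_all add: real_embedding_eq_0_iff)
  hence "\<tau>1 w = \<tau>2 w \<or> \<tau>1 w = \<tau>3 w \<or> \<tau>2 w = \<tau>3 w"
    using assms(4,5) exhaust_3[of i] exhaust_3[of j] by (auto simp: xy x hom)
  hence "\<exists>q. w = of_rat q"
  proof (elim disjE)
    have n: "\<tau>1 x * \<tau>3 x * \<tau>2 x \<in> \<rat>" "\<tau>2 x * \<tau>3 x * \<tau>1 x \<in> \<rat>" for x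
      using norm_rational[of x] by (simp_all add: mult_ac)
    show ?thesis if "\<tau>1 w = \<tau>2 w"
      using rational_if_conjugates_eq[OF emb norm_rational that] .
    show ?thesis if "\<tau>1 w = \<tau>3 w"
      using rational_if_conjugates_eq[OF emb(1,3,2) n(1) that] .
    show ?thesis if "\<tau>2 w = \<tau>3 w"
      using rational_if_conjugates_eq[OF emb(2,3,1) n(2) that] .
  qed
  thus ?thesis using iota_of_rat_mult xy x by metis
qed

end

section \<open>Lattice triangles\<close>

text \<open>The reflected point \<open>y = v0 + v1 + v2 - x\<close> lies in the triangle, and \<open>x\<close> lies in the cone over one
  of the three triangles that \<open>y\<close> cuts out, each of which contains fewer lattice points.\<close>

lemma lattice_triangle_double_decomp:
  fixes L :: "'a::real_vector set"
  assumes add: "\<And>x y. x \<in> L \<Longrightarrow> y \<in> L \<Longrightarrow> x + y \<in> L" and uminus: "\<And>x. x \<in> L \<Longrightarrow> - x \<in> L"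
    and fin: "finite (L \<inter> convex hull {v0, v1, v2})"
    and v: "v0 \<in> L" "v1 \<in> L" "v2 \<in> L" and x: "x \<in> L"
    and xc: "x = c0 *\<^sub>R v0 + c1 *\<^sub>R v1 + c2 *\<^sub>R v2"
    and c: "c0 \<ge> 0" "c1 \<ge> 0" "c2 \<ge> 0" "c0 + c1 + c2 = 2"
  shows "\<exists>p \<in> L \<inter> convex hull {v0, v1, v2}. x - p \<in> convex hull {v0, v1, v2}"
  using fin v xc c
proof (induction "card (L \<inter> convex hull {v0, v1, v2})" arbitrary: v0 v1 v2 c0 c1 c2 rule: less_induct)
  case less
  note v = \<open>v0 \<in> L\<close> \<open>v1 \<in> L\<close> \<open>v2 \<in> L\<close>
  note c = \<open>c0 \<ge> 0\<close> \<open>c1 \<ge> 0\<close> \<open>c2 \<ge> 0\<close> \<open>c0 + c1 + c2 = 2\<close>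
  have diff: "x - y \<in> L" if "x \<in> L" "y \<in> L" for x y
    using add[OF that(1) uminus[OF that(2)]] by simp
  \<comment> \<open>If some coefficient is at least 1, the corresponding vertex serves as
    \<open>p\<close>.\<close>
  have big: ?case
    if h: "{a0, a1, a2} = {v0, v1, v2}" "x = e0 *\<^sub>R a0 + e1 *\<^sub>R a1 + e2 *\<^sub>R a2"
      "e0 \<ge> 1" "e1 \<ge> 0" "e2 \<ge> 0" "e0 + e1 + e2 = 2" for a0 a1 a2 e0 e1 e2
  proof -
    have "a0 \<in> L \<inter> convex hull {v0, v1, v2}" using h(1) v by (auto intro: hull_inc)
    moreover have "x - a0 \<in> convex hull {a0, a1, a2}"
      unfolding convex_hull_3 using h
      by (intro CollectI exI[of _ "e0 - 1"] exI[of _ e1] exI[of _ e2]) (simp add: algebra_simps)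
    ultimately show ?thesis using h(1) by auto
  qed
  show ?case
  proof (cases "c0 < 1 \<and> c1 < 1 \<and> c2 < 1")
    case False
    then consider "c0 \<ge> 1" | "c1 \<ge> 1" | "c2 \<ge> 1" by linarith
    thus ?thesis
    proof cases
      case 1
      thus ?thesis using big[of v0 v1 v2 c0 c1 c2] less.prems by auto
    next
      case 2
      thus ?thesis using big[of v1 v0 v2 c1 c0 c2] less.prems by (auto simp: insert_commute add_ac)
    next
      case 3
      thus ?thesis using big[of v2 v1 v0 c2 c1 c0] less.prems by (auto simp: insert_commute add_ac)
    qed
  next
    case small: True
    \<comment> \<open>The two inequalities in \<open>min\<close>, with denominators cleared, say
      that \<open>a2\<close> has the least ratio e / (1 - e) of the three vertices. This selects the
      triangle on \<open>y\<close>, \<open>a0\<close>, \<open>a1\<close> as the one whose cone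
      contains \<open>x\<close>.\<close>
    have step: ?thesis
      if h: "{a0, a1, a2} = {v0, v1, v2}" "x = e0 *\<^sub>R a0 + e1 *\<^sub>R a1 + e2 *\<^sub>R a2"
        "e0 \<ge> 0" "e1 \<ge> 0" "e2 \<ge> 0" "e0 < 1" "e1 < 1" "e2 < 1" "e0 + e1 + e2 = 2"
        and min: "e2 * (1 - e0) \<le> e0 * (1 - e2)" "e2 * (1 - e1) \<le> e1 * (1 - e2)"
        for a0 a1 a2 e0 e1 e2
    proof -
      have "{a0, a1, a2} \<subseteq> L" unfolding h(1) using v by simp
      hence a: "a0 \<in> L" "a1 \<in> L" "a2 \<in> L" by simp_all
      define y where "y = a0 + a1 + a2 - x"
      have yL: "y \<in> L" unfolding y_def using a x by (intro diff add)
      have y: "y = (1 - e0) *\<^sub>R a0 + (1 - e1) *\<^sub>R a1 + (1 - e2) *\<^sub>R a2"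
        by (simp add: y_def h(2) algebra_simps)
      have y_hull: "y \<in> convex hull {a0, a1, a2}"
        unfolding convex_hull_3 using h
        by (intro CollectI exI[of _ "1 - e0"] exI[of _ "1 - e1"] exI[of _ "1 - e2"]) (simp add: y)
      have e2: "e2 > 0" using h by linarith
      show ?thesis
      proof (cases "a2 \<in> convex hull {y, a0, a1}")
        \<comment> \<open>The degenerate case: the vertices may be collinear, and then the triangle
          on \<open>y\<close> can be as large as the old one. Here \<open>a2\<close> lies between
          \<open>a0\<close> and \<open>a1\<close>, so \<open>x\<close> is a combination of these two
          with coefficient sum 2, and one coefficient is at least 1.\<close>
        case True
        then obtain r s t where r: "a2 = r *\<^sub>R y + s *\<^sub>R a0 + t *\<^sub>R a1"
          "r \<ge> 0" "s \<ge> 0" "t \<ge> 0" "r + s + t = 1" unfolding convex_hull_3 by blast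
        \<comment> \<open>Inserting \<open>y\<close> into the equation for \<open>a2\<close> leaves
          \<open>r * (1 - e2)\<close> of \<open>a2\<close> on the right; \<open>k\<close> is what
          remains on the left after moving it over.\<close>
        define k where "k = 1 - r * (1 - e2)"
        have "r * (1 - e2) \<le> 1 * (1 - e2)" using r h by (intro mult_right_mono) auto
        hence k: "k > 0" using e2 by (simp add: k_def)
        define s' t' where "s' = (r * (1 - e0) + s) / k" and "t' = (r * (1 - e1) + t) / k"
        have pos: "s' \<ge> 0" "t' \<ge> 0" using k r h by (auto simp: s'_def t'_def)
        have "r * (1 - e0) + s + (r * (1 - e1) + t) = r * (2 - e0 - e1) + (s + t)"
          by (simp add: algebra_simps)
        also have "\<dots> = r * e2 + (1 - r)"
        proof -
          have "2 - e0 - e1 = e2" "s + t = 1 - r" using h(9) r(5) by linarith+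
          thus ?thesis by (simp only:)
        qed
        also have "\<dots> = k" by (simp add: k_def algebra_simps)
        finally have sum1: "s' + t' = 1" using k by (simp add: s'_def t'_def add_divide_distrib[symmetric])
        have "k *\<^sub>R a2 = a2 - (r * (1 - e2)) *\<^sub>R a2" by (simp add: k_def algebra_simps)
        also have "\<dots> = (r * (1 - e0) + s) *\<^sub>R a0 + (r * (1 - e1) + t) *\<^sub>R a1"
          by (subst (1) r(1)) (simp add: y algebra_simps)
        also have "\<dots> = k *\<^sub>R (s' *\<^sub>R a0 + t' *\<^sub>R a1)"
          using k by (simp add: s'_def t'_def scaleR_right_distrib)
        finally have a2: "a2 = s' *\<^sub>R a0 + t' *\<^sub>R a1" using k by simp
        have x2: "x = (e0 + e2 * s') *\<^sub>R a0 + (e1 + e2 * t') *\<^sub>R a1 + 0 *\<^sub>R a2"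
          unfolding h(2) by (subst a2) (simp add: algebra_simps)
        have "e2 * s' + e2 * t' = e2" using sum1 by (simp add: distrib_left[symmetric])
        hence tot: "(e0 + e2 * s') + (e1 + e2 * t') = 2" using h by linarith
        have nn: "e2 * s' \<ge> 0" "e2 * t' \<ge> 0" using pos e2 by auto
        show ?thesis
        proof (cases "e0 + e2 * s' \<ge> 1")
          case True
          show ?thesis by (rule big[OF h(1) x2 True]) (use tot nn h in auto)
        next
          case False
          show ?thesis
          proof (rule big[of a1 a0 a2])
            show "{a1, a0, a2} = {v0, v1, v2}" using h(1) by blast
            show "x = (e1 + e2 * t') *\<^sub>R a1 + (e0 + e2 * s') *\<^sub>R a0 + 0 *\<^sub>R a2" using x2 by (simp add: add_ac)
          qed (use False tot nn h in auto)
        qed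
      next
        case False
        have sub: "convex hull {y, a0, a1} \<subseteq> convex hull {a0, a1, a2}"
          using y_hull by (intro hull_minimal) (auto intro: hull_inc)
        have hull: "convex hull {a0, a1, a2} = convex hull {v0, v1, v2}" using h(1) by simp
        have "L \<inter> convex hull {y, a0, a1} \<subset> L \<inter> convex hull {v0, v1, v2}"
          using sub False a(3) unfolding hull[symmetric] by (auto intro: hull_inc)
        moreover have fin: "finite (L \<inter> convex hull {v0, v1, v2})" by (rule less.prems)
        ultimately have card: "card (L \<inter> convex hull {y, a0, a1}) < card (L \<inter> convex hull {v0, v1, v2})"
          and fin': "finite (L \<inter> convex hull {y, a0, a1})"
          by (auto intro: psubset_card_mono finite_subset)
        \<comment> \<open>The multiple of \<open>y\<close> whose \<open>a2\<close>-part equals that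
          of \<open>x\<close>. Subtracting it eliminates \<open>a2\<close>, and \<open>min\<close>
          keeps the other two coefficients nonnegative. As \<open>y\<close> has coefficient sum 1,
          the total stays 2.\<close>
        define t where "t = e2 / (1 - e2)"
        have t: "t \<ge> 0" "t * (1 - e0) \<le> e0" "t * (1 - e1) \<le> e1" "t * (1 - e2) = e2"
          using h min by (auto simp: t_def field_simps)
        have "x = t *\<^sub>R y + (e0 - t * (1 - e0)) *\<^sub>R a0 + (e1 - t * (1 - e1)) *\<^sub>R a1"
        proof -
          have "t *\<^sub>R y = (t * (1 - e0)) *\<^sub>R a0 + (t * (1 - e1)) *\<^sub>R a1 + (t * (1 - e2)) *\<^sub>R a2"
            by (simp add: y scaleR_right_distrib)
          thus ?thesis unfolding h(2) t(4) by (simp add: scaleR_left_diff_distrib)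
        qed
        moreover have "t + (e0 - t * (1 - e0)) + (e1 - t * (1 - e1)) = 2"
        proof -
          have "t * (1 - e0) + t * (1 - e1) + t * (1 - e2) = t * (3 - (e0 + e1 + e2))"
            by (simp add: algebra_simps)
          also have "\<dots> = t" using h by simp
          finally show ?thesis using t(4) h(9) by linarith
        qed
        ultimately have "\<exists>p \<in> L \<inter> convex hull {y, a0, a1}. x - p \<in> convex hull {y, a0, a1}"
          using t by (intro less.hyps[OF card fin' yL a(1,2)]) auto
        thus ?thesis using sub hull by blast
      qed
    qed
    \<comment> \<open>The function e / (1 - e) is increasing, so the least ratio belongs to the
      least coefficient.\<close>
    have swap: "a * (1 - b) \<le> b * (1 - a) \<longleftrightarrow> a \<le> b" for a b :: real by (simp add: algebra_simps)
    consider "c2 \<le> c0" "c2 \<le> c1" | "c1 \<le> c0" "c1 \<le> c2" | "c0 \<le> c1" "c0 \<le> c2" by linarith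
    thus ?thesis
    proof cases
      case 1
      show ?thesis
        by (rule step[of v0 v1 v2 c0 c1 c2]) (use 1 c small less.prems in \<open>auto simp: swap\<close>)
    next
      case 2
      show ?thesis
        by (rule step[of v0 v2 v1 c0 c2 c1]) (use 2 c small less.prems in \<open>auto simp: swap insert_commute add_ac\<close>)
    next
      case 3
      show ?thesis
        by (rule step[of v2 v1 v0 c2 c1 c0]) (use 3 c small less.prems in \<open>auto simp: swap insert_commute add_ac\<close>)
    qed
  qed
qed

lemma zspan_pair:
  fixes p q :: "'a::real_vector"
  assumes "p \<noteq> q"
  shows "x \<in> zspan {p, q} \<longleftrightarrow> (\<exists>m n :: int. x = of_int m *\<^sub>R p + of_int n *\<^sub>R q)"
proof
  assume "x \<in> zspan {p, q}"
  then obtain T c where T: "T \<subseteq> {p, q}" "\<forall>v\<in>T. c v \<in> \<int>" "x = (\<Sum>v\<in>T. c v *\<^sub>R v)"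
    unfolding zspan_def by blast
  define d where "d = (\<lambda>v. if v \<in> T then c v else 0)"
  have "x = (\<Sum>v\<in>{p, q}. d v *\<^sub>R v)"
    unfolding T(3) using T(1) by (intro sum.mono_neutral_cong_left) (auto simp: d_def)
  also have "\<dots> = d p *\<^sub>R p + d q *\<^sub>R q" using assms by simp
  finally have x: "x = d p *\<^sub>R p + d q *\<^sub>R q" .
  have "d p \<in> \<int>" "d q \<in> \<int>" using T(2) by (auto simp: d_def)
  then obtain m n where "d p = of_int m" "d q = of_int n" by (auto elim!: Ints_cases)
  thus "\<exists>m n :: int. x = of_int m *\<^sub>R p + of_int n *\<^sub>R q" using x by auto
next
  assume "\<exists>m n :: int. x = of_int m *\<^sub>R p + of_int n *\<^sub>R q"
  then obtain m n :: int where x: "x = of_int m *\<^sub>R p + of_int n *\<^sub>R q" by blast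
  show "x \<in> zspan {p, q}"
    unfolding zspan_def
    by (intro CollectI exI[of _ "{p, q}"] exI[of _ "\<lambda>v. if v = p then of_int m else of_int n"])
       (use assms x in auto)
qed

section \<open>Discrete subgroups and counting in a half-open parallelepiped\<close>

locale lattice_3 =
  fixes L :: "(real^3) set"
  assumes zero_in: "0 \<in> L"
    and add_in: "x \<in> L \<Longrightarrow> y \<in> L \<Longrightarrow> x + y \<in> L"
    and uminus_in: "x \<in> L \<Longrightarrow> - x \<in> L"
    and norm_ge: "x \<in> L \<Longrightarrow> x \<noteq> 0 \<Longrightarrow> \<bar>x $ 1 * x $ 2 * x $ 3\<bar> \<ge> 1"
begin

lemma diff_in: "x \<in> L \<Longrightarrow> y \<in> L \<Longrightarrow> x - y \<in> L"
  using add_in[of x "- y"] uminus_in[of y] by simp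

lemma of_nat_scaleR_in: "x \<in> L \<Longrightarrow> real n *\<^sub>R x \<in> L"
  by (induction n) (auto simp: zero_in scaleR_left_distrib intro: add_in)

lemma of_int_scaleR_in: "x \<in> L \<Longrightarrow> of_int n *\<^sub>R x \<in> L"
  by (cases n rule: int_diff_cases) (simp add: scaleR_left_diff_distrib of_nat_scaleR_in diff_in)

text \<open>Distinct lattice points at distance below 1 would differ by a vector all of whose
  coordinates are below 1 in absolute value, against the lower bound on norms. So the lattice is
  uniformly discrete.\<close>

lemma finite_Int_bounded:
  assumes "bounded S"
  shows "finite (L \<inter> S)"
proof -
  have "x = y" if "x \<in> L" "y \<in> L" "dist x y < 1" for x y
  proof (rule ccontr)
    assume "x \<noteq> y"
    hence "1 \<le> \<bar>(x - y) $ 1 * (x - y) $ 2 * (x - y) $ 3\<bar>"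
      using that by (intro norm_ge diff_in) auto
    also have "\<dots> = \<bar>(x - y) $ 1\<bar> * \<bar>(x - y) $ 2\<bar> * \<bar>(x - y) $ 3\<bar>" by (simp add: abs_mult)
    also have "\<dots> \<le> 1 * 1 * \<bar>(x - y) $ 3\<bar>"
      using that(3) component_le_norm_cart[of "x - y"]
      by (intro mult_mono) (auto simp: dist_norm intro: order_trans less_imp_le)
    also have "\<dots> < 1" using that(3) component_le_norm_cart[of "x - y" 3] by (simp add: dist_norm)
    finally show False by simp
  qed
  hence "uniform_discrete (L \<inter> S)" unfolding uniform_discrete_def by (intro exI[of _ 1]) auto
  moreover have "bounded (L \<inter> S)" using assms by (rule bounded_subset) auto
  ultimately show ?thesis using uniform_discrete_finite_iff by blast
qed

end

text \<open>For independent vectors this is a fundamental domain of the group that they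
  generate.\<close>

definition halfopen_box :: "real^3 \<Rightarrow> real^3 \<Rightarrow> real^3 \<Rightarrow> (real^3) set" where
  "halfopen_box v0 v1 v2 = {c0 *\<^sub>R v0 + c1 *\<^sub>R v1 + c2 *\<^sub>R v2 | c0 c1 c2.
     0 \<le> c0 \<and> c0 < 1 \<and> 0 \<le> c1 \<and> c1 < 1 \<and> 0 \<le> c2 \<and> c2 < 1}"

locale face_plane = lattice_3 +
  fixes F :: "(real^3) set" and a :: "real^3"
  assumes a_ge_1: "x \<in> L \<Longrightarrow> x \<in> positive_octant \<Longrightarrow> a \<bullet> x \<ge> 1"
    and F_level: "x \<in> F \<Longrightarrow> a \<bullet> x = 1"
    and F_pos: "F \<subseteq> positive_octant"
    and F_convex: "convex F"
begin

text \<open>Once the face contains a lattice triangle, this is the group generated by the lattice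
  points of its plane, see \<open>zspan_face\<close>.\<close>

definition L_int :: "(real^3) set" where "L_int = {x \<in> L. a \<bullet> x \<in> \<int>}"

end

locale face_triangle = face_plane +
  fixes v0 v1 v2
  assumes v_in: "v0 \<in> L" "v1 \<in> L" "v2 \<in> L"
    and v_F: "v0 \<in> F" "v1 \<in> F" "v2 \<in> F"
    and v_dist: "distinct [v0, v1, v2]"
    and v_indep: "\<not> affine_dependent {v0, v1, v2}"
begin

lemma level_comb: "a \<bullet> (c0 *\<^sub>R v0 + c1 *\<^sub>R v1 + c2 *\<^sub>R v2) = c0 + c1 + c2"
  using v_F F_level by (simp add: inner_add_right)

text \<open>All three vertices have level 1, so a linear relation between them has coefficient sum 0
  and is an affine relation.\<close>

lemma comb_eq_0:
  assumes "c0 *\<^sub>R v0 + c1 *\<^sub>R v1 + c2 *\<^sub>R v2 = 0"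
  shows "c0 = 0 \<and> c1 = 0 \<and> c2 = 0"
proof (rule ccontr)
  assume nz: "\<not> ?thesis"
  define U where "U = (\<lambda>v. if v = v0 then c0 else if v = v1 then c1 else c2)"
  have "c0 + c1 + c2 = 0" using level_comb[of c0 c1 c2] assms by simp
  hence "sum U {v0, v1, v2} = 0" using v_dist by (auto simp: U_def add_ac)
  moreover have "(\<Sum>v\<in>{v0, v1, v2}. U v *\<^sub>R v) = 0" using v_dist assms by (auto simp: U_def add_ac)
  moreover have "\<exists>v\<in>{v0, v1, v2}. U v \<noteq> 0" using nz v_dist by (auto simp: U_def)
  ultimately have "affine_dependent {v0, v1, v2}"
    using affine_dependent_explicit_finite[of "{v0, v1, v2}"] by blast
  thus False using v_indep by blast
qed

lemma comb_unique:
  assumes "c0 *\<^sub>R v0 + c1 *\<^sub>R v1 + c2 *\<^sub>R v2 = d0 *\<^sub>R v0 + d1 *\<^sub>R v1 + d2 *\<^sub>R v2"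
  shows "c0 = d0 \<and> c1 = d1 \<and> c2 = d2"
proof -
  have "(c0 - d0) *\<^sub>R v0 + (c1 - d1) *\<^sub>R v1 + (c2 - d2) *\<^sub>R v2 = 0"
    using assms by (simp add: algebra_simps)
  thus ?thesis using comb_eq_0 by fastforce
qed

lemma comb_exists: "\<exists>c0 c1 c2. x = c0 *\<^sub>R v0 + c1 *\<^sub>R v1 + c2 *\<^sub>R v2"
proof -
  have "independent {v0, v1, v2}"
  proof
    assume "dependent {v0, v1, v2}"
    then obtain u where u: "\<exists>v\<in>{v0, v1, v2}. u v \<noteq> 0" "(\<Sum>v\<in>{v0, v1, v2}. u v *\<^sub>R v) = 0"
      using dependent_finite[of "{v0, v1, v2}"] by auto
    have "u v0 *\<^sub>R v0 + u v1 *\<^sub>R v1 + u v2 *\<^sub>R v2 = 0" using u(2) v_dist by (simp add: add_ac)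
    hence "u v0 = 0 \<and> u v1 = 0 \<and> u v2 = 0" by (rule comb_eq_0)
    thus False using u(1) by auto
  qed
  moreover have "card {v0, v1, v2} = 3" using v_dist by simp
  ultimately have "UNIV \<subseteq> span {v0, v1, v2}"
    by (intro card_ge_dim_independent) auto
  hence "x \<in> span {v0, v1, v2}" by blast
  then obtain c0 c1 c2 where "x - c0 *\<^sub>R v0 - c1 *\<^sub>R v1 - c2 *\<^sub>R v2 = 0"
    by (auto simp: span_breakdown_eq)
  hence "x = c0 *\<^sub>R v0 + c1 *\<^sub>R v1 + c2 *\<^sub>R v2" by (simp add: algebra_simps)
  thus ?thesis by blast
qed

definition M :: "(real^3) set" where
  "M = {of_int m0 *\<^sub>R v0 + of_int m1 *\<^sub>R v1 + of_int m2 *\<^sub>R v2 | m0 m1 m2 :: int. True}"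

lemma M_subset: "M \<subseteq> L_int"
proof
  fix x assume "x \<in> M"
  then obtain m0 m1 m2 :: int where x: "x = of_int m0 *\<^sub>R v0 + of_int m1 *\<^sub>R v1 + of_int m2 *\<^sub>R v2"
    unfolding M_def by blast
  have "x \<in> L" unfolding x by (intro add_in of_int_scaleR_in v_in)
  thus "x \<in> L_int" unfolding L_int_def by (simp add: x level_comb)
qed

lemma M_diff: "x \<in> M \<Longrightarrow> y \<in> M \<Longrightarrow> x - y \<in> M"
proof -
  assume "x \<in> M" "y \<in> M"
  then obtain m0 m1 m2 n0 n1 n2 :: int where
    "x = of_int m0 *\<^sub>R v0 + of_int m1 *\<^sub>R v1 + of_int m2 *\<^sub>R v2"
    "y = of_int n0 *\<^sub>R v0 + of_int n1 *\<^sub>R v1 + of_int n2 *\<^sub>R v2"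
    unfolding M_def by blast
  thus ?thesis unfolding M_def
    by (intro CollectI exI[of _ "m0 - n0"] exI[of _ "m1 - n1"] exI[of _ "m2 - n2"])
       (simp add: algebra_simps)
qed

lemma M_uminus: "x \<in> M \<Longrightarrow> - x \<in> M"
  using M_diff[of "x - x" x] M_diff[of x x] by simp

abbreviation "Par \<equiv> halfopen_box v0 v1 v2"

lemma Par_reduce: "\<exists>y \<in> Par. y - x \<in> M"
proof -
  obtain c0 c1 c2 where x: "x = c0 *\<^sub>R v0 + c1 *\<^sub>R v1 + c2 *\<^sub>R v2" using comb_exists by blast
  define y where "y = frac c0 *\<^sub>R v0 + frac c1 *\<^sub>R v1 + frac c2 *\<^sub>R v2"
  have "y \<in> Par" unfolding y_def halfopen_box_def
    by (intro CollectI exI[of _ "frac c0"] exI[of _ "frac c1"] exI[of _ "frac c2"])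
       (simp add: frac_ge_0 frac_lt_1)
  moreover have "y - x \<in> M" unfolding M_def y_def x
    by (intro CollectI exI[of _ "- floor c0"] exI[of _ "- floor c1"] exI[of _ "- floor c2"])
       (simp add: frac_def algebra_simps)
  ultimately show ?thesis by blast
qed

lemma Par_unique:
  assumes "x \<in> Par" "y \<in> Par" "x - y \<in> M"
  shows "x = y"
proof -
  obtain c0 c1 c2 where x: "x = c0 *\<^sub>R v0 + c1 *\<^sub>R v1 + c2 *\<^sub>R v2"
    "0 \<le> c0" "c0 < 1" "0 \<le> c1" "c1 < 1" "0 \<le> c2" "c2 < 1" using assms(1) unfolding halfopen_box_def by blast
  obtain d0 d1 d2 where y: "y = d0 *\<^sub>R v0 + d1 *\<^sub>R v1 + d2 *\<^sub>R v2"
    "0 \<le> d0" "d0 < 1" "0 \<le> d1" "d1 < 1" "0 \<le> d2" "d2 < 1" using assms(2) unfolding halfopen_box_def by blast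
  obtain m0 m1 m2 :: int where m: "x - y = of_int m0 *\<^sub>R v0 + of_int m1 *\<^sub>R v1 + of_int m2 *\<^sub>R v2"
    using assms(3) unfolding M_def by blast
  have "(c0 - d0) *\<^sub>R v0 + (c1 - d1) *\<^sub>R v1 + (c2 - d2) *\<^sub>R v2
      = of_int m0 *\<^sub>R v0 + of_int m1 *\<^sub>R v1 + of_int m2 *\<^sub>R v2"
    using m by (simp add: x(1) y(1) algebra_simps)
  hence "c0 - d0 = of_int m0 \<and> c1 - d1 = of_int m1 \<and> c2 - d2 = of_int m2" by (rule comb_unique)
  moreover have "m0 = 0" "m1 = 0" "m2 = 0" using calculation x y by linarith+
  ultimately show ?thesis using x(1) y(1) by simp
qed

lemma finite_L_Par: "finite (L \<inter> Par)"
proof (rule finite_Int_bounded)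
  show "bounded Par"
  proof (rule boundedI)
    fix x assume "x \<in> Par"
    then obtain c0 c1 c2 where x: "x = c0 *\<^sub>R v0 + c1 *\<^sub>R v1 + c2 *\<^sub>R v2"
      "0 \<le> c0" "c0 < 1" "0 \<le> c1" "c1 < 1" "0 \<le> c2" "c2 < 1" unfolding halfopen_box_def by blast
    have "norm x \<le> norm (c0 *\<^sub>R v0) + norm (c1 *\<^sub>R v1) + norm (c2 *\<^sub>R v2)"
      unfolding x(1) by (intro norm_triangle_le add_mono order_refl)
    also have "\<dots> \<le> norm v0 + norm v1 + norm v2"
      using x by (intro add_mono) (auto intro!: mult_left_le_one_le)
    finally show "norm x \<le> norm v0 + norm v1 + norm v2" .
  qed
qed

lemma affine_hull_F: "affine hull F = {x. a \<bullet> x = 1}"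
proof
  show "affine hull F \<subseteq> {x. a \<bullet> x = 1}"
    by (rule hull_minimal) (auto simp: F_level affine_hyperplane)
  show "{x. a \<bullet> x = 1} \<subseteq> affine hull F"
  proof
    fix x assume "x \<in> {x. a \<bullet> x = 1}"
    moreover obtain c0 c1 c2 where x: "x = c0 *\<^sub>R v0 + c1 *\<^sub>R v1 + c2 *\<^sub>R v2" using comb_exists by blast
    ultimately have "c0 + c1 + c2 = 1" using level_comb by simp
    hence "x \<in> affine hull {v0, v1, v2}" unfolding affine_hull_3 x by blast
    thus "x \<in> affine hull F" using v_F hull_mono[of "{v0, v1, v2}" F affine] by auto
  qed
qed

text \<open>A lattice point of integral level n is \<open>(n - 1)\<close> times \<open>v0\<close>
  plus a lattice point of level 1.\<close>

lemma zspan_face: "zspan (affine hull F \<inter> L) = L_int"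
proof
  show "zspan (affine hull F \<inter> L) \<subseteq> L_int"
  proof
    fix x assume "x \<in> zspan (affine hull F \<inter> L)"
    then obtain T c where T: "finite T" "T \<subseteq> {x. a \<bullet> x = 1} \<inter> L" "\<forall>v\<in>T. c v \<in> \<int>"
      "x = (\<Sum>v\<in>T. c v *\<^sub>R v)" unfolding zspan_def affine_hull_F by blast
    have "(\<Sum>v\<in>T. c v *\<^sub>R v) \<in> L \<and> a \<bullet> (\<Sum>v\<in>T. c v *\<^sub>R v) \<in> \<int>"
      using T(1-3)
    proof (induction T rule: finite_induct)
      case (insert v T)
      obtain n where n: "c v = of_int n" using insert.prems by (auto elim!: Ints_cases)
      have "a \<bullet> v = 1" "v \<in> L" using insert.prems by auto
      thus ?case using insert n by (auto simp: inner_add_right intro!: add_in of_int_scaleR_in)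
    qed (simp add: zero_in)
    thus "x \<in> L_int" by (simp add: T(4) L_int_def)
  qed
  show "L_int \<subseteq> zspan (affine hull F \<inter> L)"
  proof
    fix x assume "x \<in> L_int"
    then obtain n where x: "x \<in> L" and n: "a \<bullet> x = of_int n" unfolding L_int_def by (auto elim!: Ints_cases)
    define y where "y = x - of_int (n - 1) *\<^sub>R v0"
    have y: "y \<in> L" "a \<bullet> y = 1"
      using diff_in[OF x of_int_scaleR_in[OF v_in(1), of "n - 1"]] n v_F F_level[of v0]
      unfolding y_def by (auto simp: inner_diff_right)
    show "x \<in> zspan (affine hull F \<inter> L)"
    proof (cases "y = v0")
      case True
      hence "x = of_int n *\<^sub>R v0" by (simp add: y_def algebra_simps)
      thus ?thesis unfolding zspan_def affine_hull_F using v_in v_F F_level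
        by (intro CollectI exI[of _ "{v0}"] exI[of _ "\<lambda>_. of_int n"]) auto
    next
      case False
      have "x \<in> zspan {y, v0}"
        unfolding zspan_pair[OF False]
        by (intro exI[of _ 1] exI[of _ "n - 1"]) (simp add: y_def)
      moreover have "{y, v0} \<subseteq> affine hull F \<inter> L" unfolding affine_hull_F using y v_in v_F F_level by auto
      ultimately show ?thesis unfolding zspan_def by blast
    qed
  qed
qed

lemma ID_eq: "ID L F = card ((\<lambda>x. {y \<in> L. y - x \<in> L_int}) ` L)"
proof -
  have "span (affine hull F) = UNIV"
  proof -
    have "x \<in> span (affine hull F)" for x
    proof -
      obtain c0 c1 c2 where x: "x = c0 *\<^sub>R v0 + c1 *\<^sub>R v1 + c2 *\<^sub>R v2" using comb_exists by blast
      show ?thesis unfolding x using v_F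
        by (intro span_add span_scale span_base) (auto intro: hull_inc)
    qed
    thus ?thesis by blast
  qed
  thus ?thesis unfolding ID_def group_index_def zspan_face by simp
qed

text \<open>The group \<open>L_int\<close> is the direct sum of its level-0 part and the multiples
  of \<open>v0\<close>, and \<open>M\<close> splits in the same way with level-0 part generated by
  \<open>p\<close> and \<open>q\<close>. So the index defining the integer volume equals the index
  of \<open>M\<close> in \<open>L_int\<close>, which the box counts.\<close>

lemma simplex_IV_eq: "simplex_IV L [v0, v1, v2] = card (L_int \<inter> Par)"
proof -
  define p q where "p = v1 - v0" and "q = v2 - v0"
  have pq: "p \<noteq> q" using v_dist by (auto simp: p_def q_def)
  define L0 where "L0 = L \<inter> span {p, q}"
  define c where "c = (\<lambda>x. {y \<in> L0. y - x \<in> zspan {p, q}})"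
  have L0: "x \<in> L0 \<longleftrightarrow> x \<in> L \<and> a \<bullet> x = 0" for x
  proof -
    have "x \<in> span {p, q} \<longleftrightarrow> a \<bullet> x = 0"
    proof
      assume "x \<in> span {p, q}"
      then obtain s t where "x - s *\<^sub>R p - t *\<^sub>R q = 0" by (auto simp: span_breakdown_eq)
      hence "x = s *\<^sub>R p + t *\<^sub>R q" by (simp add: algebra_simps)
      thus "a \<bullet> x = 0" using v_F F_level by (simp add: p_def q_def inner_add_right inner_diff_right)
    next
      assume "a \<bullet> x = 0"
      moreover obtain c0 c1 c2 where x: "x = c0 *\<^sub>R v0 + c1 *\<^sub>R v1 + c2 *\<^sub>R v2" using comb_exists by blast
      ultimately have "c0 = - c1 - c2" using level_comb[of c0 c1 c2] by simp
      hence "x = c1 *\<^sub>R p + c2 *\<^sub>R q"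
        unfolding x p_def q_def by (simp only:) (simp add: algebra_simps)
      thus "x \<in> span {p, q}" by (simp add: span_add span_scale span_base)
    qed
    thus ?thesis by (simp add: L0_def)
  qed
  have z_M: "x \<in> zspan {p, q} \<longleftrightarrow> x \<in> M \<and> a \<bullet> x = 0" for x
  proof
    assume "x \<in> zspan {p, q}"
    then obtain m n :: int where "x = of_int m *\<^sub>R p + of_int n *\<^sub>R q" unfolding zspan_pair[OF pq] by blast
    hence x: "x = of_int (- m - n) *\<^sub>R v0 + of_int m *\<^sub>R v1 + of_int n *\<^sub>R v2"
      by (simp add: p_def q_def algebra_simps)
    have "a \<bullet> x = 0" unfolding x level_comb by simp
    moreover have "x \<in> M" unfolding M_def using x by blast
    ultimately show "x \<in> M \<and> a \<bullet> x = 0" by blast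
  next
    assume h: "x \<in> M \<and> a \<bullet> x = 0"
    then obtain k m n :: int where x: "x = of_int k *\<^sub>R v0 + of_int m *\<^sub>R v1 + of_int n *\<^sub>R v2"
      unfolding M_def by blast
    have "real_of_int k + of_int m + of_int n = 0" using h level_comb unfolding x by simp
    hence "real_of_int k = - of_int m - of_int n" by linarith
    hence "x = of_int m *\<^sub>R p + of_int n *\<^sub>R q"
      unfolding x p_def q_def by (simp only:) (simp add: algebra_simps)
    thus "x \<in> zspan {p, q}" unfolding zspan_pair[OF pq] by blast
  qed
  \<comment> \<open>The projection to level 0 along \<open>v0\<close>; on \<open>L_int\<close> it
    changes a point by an element of \<open>M\<close> only.\<close>
  define f where "f = (\<lambda>y. y - (a \<bullet> y) *\<^sub>R v0)"
  have af: "a \<bullet> f y = 0" for y using v_F F_level[of v0] by (simp add: f_def inner_diff_right)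
  have f_L0: "f y \<in> L0" if "y \<in> L_int" for y
  proof -
    have "a \<bullet> y \<in> \<int>" "y \<in> L" using that by (simp_all add: L_int_def)
    moreover from this(1) obtain n where "a \<bullet> y = of_int n" by (rule Ints_cases)
    ultimately have "f y \<in> L" by (auto simp: f_def intro!: diff_in of_int_scaleR_in v_in)
    thus ?thesis unfolding L0 using af by blast
  qed
  have nM: "of_int n *\<^sub>R v0 \<in> M" for n :: int
    unfolding M_def by (intro CollectI exI[of _ n] exI[of _ 0]) simp
  have f_M: "f y - y \<in> M" if "y \<in> L_int" for y
  proof -
    have "a \<bullet> y \<in> \<int>" using that by (simp add: L_int_def)
    then obtain n where "a \<bullet> y = of_int n" by (rule Ints_cases)
    thus ?thesis using M_uminus[OF nM[of n]] by (simp add: f_def)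
  qed
  have c_eq: "c x = c y \<longleftrightarrow> x - y \<in> M" if "x \<in> L0" "y \<in> L0" for x y
  proof
    assume "c x = c y"
    moreover have "x \<in> c x" using that M_diff[OF nM[of 0] nM[of 0]] by (simp add: c_def z_M)
    ultimately show "x - y \<in> M" by (simp add: c_def z_M)
  next
    assume h: "x - y \<in> M"
    have "z - x \<in> M \<longleftrightarrow> z - y \<in> M" for z
      using M_diff[of "z - y" "x - y"] M_diff[of "z - x" "y - x"] M_uminus[OF h] h by auto
    moreover have "a \<bullet> x = a \<bullet> y" using that L0 by simp
    ultimately show "c x = c y" by (simp add: c_def z_M inner_diff_right)
  qed
  have "bij_betw (\<lambda>y. c (f y)) (L_int \<inter> Par) (c ` L0)"
    unfolding bij_betw_def
  proof
    show "inj_on (\<lambda>y. c (f y)) (L_int \<inter> Par)"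
    proof (rule inj_onI)
      fix x y assume xy: "x \<in> L_int \<inter> Par" "y \<in> L_int \<inter> Par" "c (f x) = c (f y)"
      hence "f x - f y \<in> M" using c_eq f_L0 by auto
      moreover have "f x - x \<in> M" "f y - y \<in> M" using f_M xy by blast+
      ultimately have "((f x - f y) - (f x - x)) - (- (f y - y)) \<in> M"
        by (blast intro: M_diff M_uminus)
      hence "x - y \<in> M" by simp
      thus "x = y" using Par_unique xy by blast
    qed
    show "(\<lambda>y. c (f y)) ` (L_int \<inter> Par) = c ` L0"
    proof
      show "(\<lambda>y. c (f y)) ` (L_int \<inter> Par) \<subseteq> c ` L0" using f_L0 by auto
      show "c ` L0 \<subseteq> (\<lambda>y. c (f y)) ` (L_int \<inter> Par)"
      proof
        fix C assume "C \<in> c ` L0"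
        then obtain x where x: "x \<in> L0" "C = c x" by blast
        obtain y where y: "y \<in> Par" "y - x \<in> M" using Par_reduce by blast
        have "y - x \<in> L_int" using y M_subset by blast
        hence "y \<in> L_int" using x L0 add_in[of "y - x" x] by (auto simp: L_int_def inner_diff_right)
        have "f y - x \<in> M"
          using M_diff[OF y(2) M_uminus[OF f_M[OF \<open>y \<in> L_int\<close>]]] by simp
        hence "c (f y) = c x" using c_eq[OF f_L0[OF \<open>y \<in> L_int\<close>] x(1)] by simp
        thus "C \<in> (\<lambda>y. c (f y)) ` (L_int \<inter> Par)" using x y \<open>y \<in> L_int\<close> by blast
      qed
    qed
  qed
  hence "card (L_int \<inter> Par) = card (c ` L0)" by (rule bij_betw_same_card)
  moreover have "simplex_IV L [v0, v1, v2] = card (c ` L0)"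
    by (simp add: group_index_def c_def L0_def p_def q_def)
  ultimately show ?thesis by simp
qed

lemma L_int_diff: "x \<in> L_int \<Longrightarrow> y \<in> L_int \<Longrightarrow> x - y \<in> L_int"
  by (auto simp: L_int_def inner_diff_right intro: diff_in)

lemma L_int_uminus: "x \<in> L_int \<Longrightarrow> - x \<in> L_int"
  by (auto simp: L_int_def intro: uminus_in)

text \<open>Every coset of \<open>L_int\<close> in \<open>L\<close> has equally many points in the
  box: translating by a representative and reducing modulo \<open>M\<close>, which lies in
  \<open>L_int\<close>, is a bijection whose inverse translates back and reduces again.\<close>

lemma card_L_Par: "card (L \<inter> Par) = ID L F * card (L_int \<inter> Par)"
proof -
  define c where "c = (\<lambda>x. {y \<in> L. y - x \<in> L_int})"
  have c_eq: "c x = c y \<longleftrightarrow> x - y \<in> L_int" if "x \<in> L" "y \<in> L" for x y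
  proof
    assume "c x = c y"
    moreover have "x \<in> c x" using that zero_in by (simp add: c_def L_int_def)
    ultimately show "x - y \<in> L_int" by (simp add: c_def)
  next
    assume h: "x - y \<in> L_int"
    have "z - x \<in> L_int \<longleftrightarrow> z - y \<in> L_int" for z
      using L_int_diff[of "z - y" "x - y"] L_int_diff[of "z - x" "y - x"] L_int_uminus[OF h] h by auto
    thus "c x = c y" by (simp add: c_def)
  qed
  have c_self: "x \<in> c x" if "x \<in> L" for x using that zero_in by (simp add: c_def L_int_def)
  have card_c: "card (c x \<inter> Par) = card (L_int \<inter> Par)" if x: "x \<in> L" for x
  proof -
    obtain r where r: "\<And>y. r y \<in> Par" "\<And>y. r y - y \<in> M" using Par_reduce by metis
    have "bij_betw (\<lambda>y. r (y + x)) (L_int \<inter> Par) (c x \<inter> Par)"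
    proof (rule bij_betw_byWitness[of _ "\<lambda>y. r (y - x)"])
      show "\<forall>y\<in>L_int \<inter> Par. r (r (y + x) - x) = y"
      proof
        fix y assume y: "y \<in> L_int \<inter> Par"
        have "(r (r (y + x) - x) - (r (y + x) - x)) - (- (r (y + x) - (y + x))) \<in> M"
          by (intro M_diff M_uminus r)
        hence "r (r (y + x) - x) - y \<in> M" by (simp add: algebra_simps)
        thus "r (r (y + x) - x) = y" using y r by (intro Par_unique) auto
      qed
      show "\<forall>y\<in>c x \<inter> Par. r (r (y - x) + x) = y"
      proof
        fix y assume y: "y \<in> c x \<inter> Par"
        have "(r (r (y - x) + x) - (r (y - x) + x)) - (- (r (y - x) - (y - x))) \<in> M"
          by (intro M_diff M_uminus r)
        hence "r (r (y - x) + x) - y \<in> M" by (simp add: algebra_simps)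
        thus "r (r (y - x) + x) = y" using y r by (intro Par_unique) auto
      qed
      show "(\<lambda>y. r (y + x)) ` (L_int \<inter> Par) \<subseteq> c x \<inter> Par"
      proof safe
        fix y assume y: "y \<in> L_int"
        have 1: "(r (y + x) - (y + x)) - (- y) \<in> L_int"
          using r(2)[of "y + x"] M_subset L_int_uminus[OF y] by (blast intro: L_int_diff)
        hence "r (y + x) - x \<in> L_int" by (simp add: algebra_simps)
        moreover from this have "r (y + x) \<in> L" using add_in[OF _ x, of "r (y + x) - x"] by (simp add: L_int_def)
        ultimately show "r (y + x) \<in> c x" by (simp add: c_def)
      qed (rule r)
      show "(\<lambda>y. r (y - x)) ` (c x \<inter> Par) \<subseteq> L_int \<inter> Par"
      proof safe
        fix y assume y: "y \<in> c x"
        have "- (y - x) \<in> L_int" using y by (intro L_int_uminus) (simp add: c_def)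
        hence "(r (y - x) - (y - x)) - (- (y - x)) \<in> L_int"
          using r(2)[of "y - x"] M_subset by (blast intro: L_int_diff)
        thus "r (y - x) \<in> L_int" by (simp add: algebra_simps)
      qed (rule r)
    qed
    thus ?thesis by (metis bij_betw_same_card)
  qed
  \<comment> \<open>Reduction modulo \<open>M\<close> stays within a coset of \<open>L_int\<close>,
    so every coset meets the finite set of lattice points in the box. This shows that ID is a true
    finite index and not the default cardinality 0 of an infinite set.\<close>
  have fin: "finite (c ` L)"
  proof (rule finite_surj)
    show "finite (L \<inter> Par)" by (rule finite_L_Par)
    show "c ` L \<subseteq> c ` (L \<inter> Par)"
    proof
      fix C assume "C \<in> c ` L"
      then obtain x where x: "x \<in> L" "C = c x" by blast
      obtain y where y: "y \<in> Par" "y - x \<in> M" using Par_reduce by blast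
      hence "y - x \<in> L_int" using M_subset by blast
      moreover from this have "y \<in> L" using add_in[OF _ x(1), of "y - x"] by (simp add: L_int_def)
      ultimately show "C \<in> c ` (L \<inter> Par)" using c_eq[of y x] x y by blast
    qed
  qed
  have "L \<inter> Par = (\<Union>C\<in>c ` L. C \<inter> Par)"
    using c_self by (auto simp: c_def)
  also have "card \<dots> = (\<Sum>C\<in>c ` L. card (C \<inter> Par))"
  proof (rule card_UN_disjoint[OF fin])
    show "\<forall>C\<in>c ` L. finite (C \<inter> Par)"
    proof
      fix C assume "C \<in> c ` L"
      hence "C \<inter> Par \<subseteq> L \<inter> Par" by (auto simp: c_def)
      thus "finite (C \<inter> Par)" by (rule finite_subset[OF _ finite_L_Par])
    qed
    show "\<forall>C\<in>c ` L. \<forall>D\<in>c ` L. C \<noteq> D \<longrightarrow> C \<inter> Par \<inter> (D \<inter> Par) = {}"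
    proof (intro ballI impI, rule ccontr)
      fix C D assume "C \<in> c ` L" "D \<in> c ` L" "C \<noteq> D" "C \<inter> Par \<inter> (D \<inter> Par) \<noteq> {}"
      then obtain x y z where "x \<in> L" "y \<in> L" "C = c x" "D = c y" "c x \<noteq> c y" "z \<in> c x" "z \<in> c y"
        by blast
      moreover from this have "c z = c x" "c z = c y" using c_eq by (auto simp: c_def)
      ultimately show False by simp
    qed
  qed
  also have "\<dots> = (\<Sum>C\<in>c ` L. card (L_int \<inter> Par))" by (rule sum.cong) (auto simp: card_c)
  also have "\<dots> = ID L F * card (L_int \<inter> Par)" by (simp add: ID_eq c_def)
  finally show ?thesis .
qed

lemma card_Par_nonint:
  "int (card {x \<in> L \<inter> Par. a \<bullet> x \<notin> \<int>}) = (int (ID L F) - 1) * int (simplex_IV L [v0, v1, v2])"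
proof -
  have "{x \<in> L \<inter> Par. a \<bullet> x \<notin> \<int>} = L \<inter> Par - L_int \<inter> Par" by (auto simp: L_int_def)
  moreover have "L_int \<inter> Par \<subseteq> L \<inter> Par" by (auto simp: L_int_def)
  ultimately have "int (card {x \<in> L \<inter> Par. a \<bullet> x \<notin> \<int>}) = int (card (L \<inter> Par)) - int (card (L_int \<inter> Par))"
    using finite_L_Par by (simp only: card_Diff_subset finite_subset of_nat_diff card_mono)
  thus ?thesis unfolding card_L_Par simplex_IV_eq by (simp add: algebra_simps)
qed

end

section \<open>Box points of non-integral level and indecomposables over one triangle\<close>

context face_triangle
begin

lemma comb_pos:
  assumes "c0 \<ge> 0" "c1 \<ge> 0" "c2 \<ge> 0" "c0 + c1 + c2 > 0"
  shows "c0 *\<^sub>R v0 + c1 *\<^sub>R v1 + c2 *\<^sub>R v2 \<in> positive_octant"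
proof -
  have p: "v0 $ i > 0" "v1 $ i > 0" "v2 $ i > 0" for i
    using v_F F_pos unfolding positive_octant_def by auto
  have "0 < c0 * v0 $ i + c1 * v1 $ i + c2 * v2 $ i" for i
  proof -
    consider "c0 > 0" | "c1 > 0" | "c2 > 0" using assms by linarith
    moreover have "c0 * v0 $ i \<ge> 0" "c1 * v1 $ i \<ge> 0" "c2 * v2 $ i \<ge> 0"
      using assms p[of i] by (auto intro: less_imp_le)
    ultimately show ?thesis using mult_pos_pos[OF _ p(1)[of i], of c0]
      mult_pos_pos[OF _ p(2)[of i], of c1] mult_pos_pos[OF _ p(3)[of i], of c2]
      by cases linarith+
  qed
  thus ?thesis unfolding positive_octant_def by simp
qed

lemma hull_in_F: "convex hull {v0, v1, v2} \<subseteq> F"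
  using v_F F_convex by (intro hull_minimal) auto

lemma in_hull:
  assumes "c0 \<ge> 0" "c1 \<ge> 0" "c2 \<ge> 0" "c0 + c1 + c2 = 1"
  shows "c0 *\<^sub>R v0 + c1 *\<^sub>R v1 + c2 *\<^sub>R v2 \<in> convex hull {v0, v1, v2}"
  unfolding convex_hull_3 using assms by blast

lemma Par_nonint:
  assumes x: "x \<in> L" "x \<in> Par" "a \<bullet> x \<notin> \<int>"
  shows "1 < a \<bullet> x" "a \<bullet> x < 2"
    "\<exists>c0 c1 c2. x = c0 *\<^sub>R v0 + c1 *\<^sub>R v1 + c2 *\<^sub>R v2 \<and> c0 > 0 \<and> c1 > 0 \<and> c2 > 0"
proof -
  obtain c0 c1 c2 where xc: "x = c0 *\<^sub>R v0 + c1 *\<^sub>R v1 + c2 *\<^sub>R v2"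
    and c: "0 \<le> c0" "c0 < 1" "0 \<le> c1" "c1 < 1" "0 \<le> c2" "c2 < 1" using x(2) unfolding halfopen_box_def by blast
  have lev: "a \<bullet> x = c0 + c1 + c2" unfolding xc by (rule level_comb)
  have ne: "a \<bullet> x \<noteq> of_int n" for n using x(3) by auto
  have "c0 + c1 + c2 > 0" using ne[of 0] c lev by auto
  hence "a \<bullet> x \<ge> 1" using a_ge_1[OF x(1)] comb_pos c xc by blast
  thus gt1: "1 < a \<bullet> x" using ne[of 1] by auto
  \<comment> \<open>With all \<open>d\<close> equal to 1 this is the reflection in the box and
    bounds the level by 2. If one \<open>c\<close> vanished, setting the matching \<open>d\<close>
    to 0 would reflect within a two-dimensional face of the box and bound the level by 1, which is
    already excluded.\<close>
  have refl: "d0 + d1 + d2 - (c0 + c1 + c2) \<ge> 1"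
    if "d0 \<in> {0, 1}" "d1 \<in> {0, 1}" "d2 \<in> {0, 1}" "c0 \<le> d0" "c1 \<le> d1" "c2 \<le> d2" "d0 + d1 + d2 > c0 + c1 + c2"
    for d0 d1 d2 :: real
  proof -
    have L: "d *\<^sub>R v \<in> L" if "d \<in> {0, 1::real}" "v \<in> L" for d v using that zero_in by auto
    have "(d0 *\<^sub>R v0 + d1 *\<^sub>R v1 + d2 *\<^sub>R v2) - x = (d0 - c0) *\<^sub>R v0 + (d1 - c1) *\<^sub>R v1 + (d2 - c2) *\<^sub>R v2"
      by (simp add: xc algebra_simps)
    moreover have "\<dots> \<in> positive_octant" using that by (intro comb_pos) auto
    moreover have "(d0 *\<^sub>R v0 + d1 *\<^sub>R v1 + d2 *\<^sub>R v2) - x \<in> L"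
      using that v_in x by (intro diff_in add_in L) auto
    ultimately have "a \<bullet> ((d0 - c0) *\<^sub>R v0 + (d1 - c1) *\<^sub>R v1 + (d2 - c2) *\<^sub>R v2) \<ge> 1" using a_ge_1 by simp
    thus ?thesis unfolding level_comb by linarith
  qed
  have "c0 + c1 + c2 \<le> 2" using refl[of 1 1 1] c by simp
  thus "a \<bullet> x < 2" using ne[of 2] lev by simp
  have "c0 \<noteq> 0" using refl[of 0 1 1] c gt1 lev by auto
  moreover have "c1 \<noteq> 0" using refl[of 1 0 1] c gt1 lev by auto
  moreover have "c2 \<noteq> 0" using refl[of 1 1 0] c gt1 lev by auto
  ultimately show "\<exists>c0 c1 c2. x = c0 *\<^sub>R v0 + c1 *\<^sub>R v1 + c2 *\<^sub>R v2 \<and> c0 > 0 \<and> c1 > 0 \<and> c2 > 0"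
    using xc c by (metis less_eq_real_def)
qed

text \<open>Scaling to level 1 keeps the coefficients positive. Triangles with disjoint relative
  interiors therefore cannot share such a box point.\<close>

lemma Par_nonint_rel_interior:
  assumes x: "x \<in> L" "x \<in> Par" "a \<bullet> x \<notin> \<int>"
  shows "(1 / (a \<bullet> x)) *\<^sub>R x \<in> rel_interior (convex hull {v0, v1, v2})"
proof -
  obtain c0 c1 c2 where c: "x = c0 *\<^sub>R v0 + c1 *\<^sub>R v1 + c2 *\<^sub>R v2" "c0 > 0" "c1 > 0" "c2 > 0"
    using Par_nonint(3)[OF x] by blast
  define s where "s = a \<bullet> x"
  have s: "s = c0 + c1 + c2" unfolding s_def c(1) by (rule level_comb)
  have "s > 0" using c s by simp
  define u where "u = (\<lambda>v. if v = v0 then c0 / s else if v = v1 then c1 / s else c2 / s)"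
  have "\<forall>v\<in>{v0, v1, v2}. 0 < u v" using c \<open>s > 0\<close> by (auto simp: u_def)
  moreover have "sum u {v0, v1, v2} = 1"
  proof -
    have "sum u {v0, v1, v2} = c0 / s + c1 / s + c2 / s" using v_dist by (auto simp: u_def)
    also have "\<dots> = (c0 + c1 + c2) / s" by (simp add: add_divide_distrib)
    finally show ?thesis using \<open>s > 0\<close> s by simp
  qed
  moreover have "(\<Sum>v\<in>{v0, v1, v2}. u v *\<^sub>R v) = (1 / s) *\<^sub>R x"
    using v_dist unfolding c(1) by (auto simp: u_def scaleR_right_distrib)
  ultimately show ?thesis
    unfolding rel_interior_convex_hull_explicit[OF v_indep] s_def[symmetric] by blast
qed

lemma Par_nonint_indecomposable:
  assumes x: "x \<in> L" "x \<in> Par" "a \<bullet> x \<notin> \<int>"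
  shows "x \<in> positive_octant" "\<exists>t y. t > 0 \<and> y \<in> F \<and> x = t *\<^sub>R y" "x \<notin> F"
    "\<not> (\<exists>y z. y \<in> L \<inter> positive_octant \<and> z \<in> L \<inter> positive_octant \<and> x = y + z)"
proof -
  obtain c0 c1 c2 where c: "x = c0 *\<^sub>R v0 + c1 *\<^sub>R v1 + c2 *\<^sub>R v2" "c0 > 0" "c1 > 0" "c2 > 0"
    using Par_nonint(3)[OF x] by blast
  show "x \<in> positive_octant" unfolding c(1) using c by (intro comb_pos) auto
  have "(1 / (a \<bullet> x)) *\<^sub>R x \<in> F"
    using Par_nonint_rel_interior[OF x] hull_in_F rel_interior_subset by blast
  moreover have "x = (a \<bullet> x) *\<^sub>R (1 / (a \<bullet> x)) *\<^sub>R x" "a \<bullet> x > 0" using Par_nonint(1)[OF x] by auto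
  ultimately show "\<exists>t y. t > 0 \<and> y \<in> F \<and> x = t *\<^sub>R y" by blast
  show "x \<notin> F" using F_level x by auto
  show "\<not> (\<exists>y z. y \<in> L \<inter> positive_octant \<and> z \<in> L \<inter> positive_octant \<and> x = y + z)"
  proof
    assume "\<exists>y z. y \<in> L \<inter> positive_octant \<and> z \<in> L \<inter> positive_octant \<and> x = y + z"
    then obtain y z where "y \<in> L \<inter> positive_octant" "z \<in> L \<inter> positive_octant" "x = y + z" by blast
    hence "a \<bullet> x \<ge> 1 + 1" using a_ge_1[of y] a_ge_1[of z] by (simp add: inner_add_right)
    thus False using Par_nonint(2)[OF x] by simp
  qed
qed

lemma indecomposable_in_Par:
  assumes x: "x \<in> L" "x = t *\<^sub>R y" "t > 0" "y \<in> convex hull {v0, v1, v2}" "x \<notin> F"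
    and ind: "\<not> (\<exists>y z. y \<in> L \<inter> positive_octant \<and> z \<in> L \<inter> positive_octant \<and> x = y + z)"
  shows "x \<in> Par" "a \<bullet> x \<notin> \<int>"
proof -
  obtain d0 d1 d2 where d: "y = d0 *\<^sub>R v0 + d1 *\<^sub>R v1 + d2 *\<^sub>R v2"
    "d0 \<ge> 0" "d1 \<ge> 0" "d2 \<ge> 0" "d0 + d1 + d2 = 1" using x(4) unfolding convex_hull_3 by blast
  define c0 c1 c2 where "c0 = t * d0" and "c1 = t * d1" and "c2 = t * d2"
  have xc: "x = c0 *\<^sub>R v0 + c1 *\<^sub>R v1 + c2 *\<^sub>R v2"
    by (simp add: x(2) d(1) c0_def c1_def c2_def scaleR_right_distrib)
  have c: "c0 \<ge> 0" "c1 \<ge> 0" "c2 \<ge> 0" using d x(3) by (auto simp: c0_def c1_def c2_def)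
  have lev: "a \<bullet> x = c0 + c1 + c2" unfolding xc by (rule level_comb)
  have "c0 + c1 + c2 = t * (d0 + d1 + d2)" by (simp add: c0_def c1_def c2_def algebra_simps)
  hence "c0 + c1 + c2 = t" using d(5) by simp
  hence t: "a \<bullet> x = t" using lev by simp
  have v_pos: "v \<in> positive_octant" if "v \<in> F" for v using that F_pos by blast
  \<comment> \<open>If a lattice point \<open>v\<close> of the face can be subtracted within the
    closed cone, then \<open>x - v\<close> is totally positive and splits \<open>x\<close>, or it is
    0 and \<open>x\<close> lies in the face. Taking vertices for \<open>v\<close> bounds each
    coefficient by 1.\<close>
  have small: False
    if e: "x - v = e0 *\<^sub>R v0 + e1 *\<^sub>R v1 + e2 *\<^sub>R v2" "e0 \<ge> 0" "e1 \<ge> 0" "e2 \<ge> 0" "v \<in> L" "v \<in> F"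
    for v e0 e1 e2
  proof (cases "e0 + e1 + e2 > 0")
    case True
    hence "x - v \<in> L \<inter> positive_octant"
      using comb_pos[OF e(2-4)] diff_in[OF x(1) e(5)] e(1) by simp
    moreover have "v \<in> L \<inter> positive_octant" using e v_pos by blast
    moreover have "x = v + (x - v)" by simp
    ultimately show False using ind by blast
  next
    case False
    hence "e0 = 0" "e1 = 0" "e2 = 0" using e by linarith+
    hence "x = v" using e(1) by simp
    thus False using x(5) e(6) by simp
  qed
  have c0: "c0 < 1"
    using small[of v0 "c0 - 1" c1 c2] c v_in v_F by (force simp: xc algebra_simps)
  have c1: "c1 < 1"
    using small[of v1 c0 "c1 - 1" c2] c v_in v_F by (force simp: xc algebra_simps)
  have c2: "c2 < 1"
    using small[of v2 c0 c1 "c2 - 1"] c v_in v_F by (force simp: xc algebra_simps)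
  show "x \<in> Par" unfolding halfopen_box_def using xc c c0 c1 c2 by blast
  show "a \<bullet> x \<notin> \<int>"
  proof
    assume "a \<bullet> x \<in> \<int>"
    then obtain n where n: "a \<bullet> x = of_int n" by (rule Ints_cases)
    have "0 < n" "n < 3" using n t x(3) lev c0 c1 c2 by linarith+
    hence "n = 1 \<or> n = 2" by linarith
    thus False
    proof
      assume "n = 1"
      hence "x \<in> convex hull {v0, v1, v2}" unfolding xc using n lev c by (intro in_hull) auto
      thus False using hull_in_F x(5) by blast
    next
      assume "n = 2"
      have "finite (L \<inter> convex hull {v0, v1, v2})"
        by (intro finite_Int_bounded bounded_convex_hull finite_imp_bounded) auto
      hence "\<exists>p \<in> L \<inter> convex hull {v0, v1, v2}. x - p \<in> convex hull {v0, v1, v2}"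
        using \<open>n = 2\<close> n lev c
        by (intro lattice_triangle_double_decomp[OF add_in uminus_in _ v_in x(1) xc]) auto
      then obtain p where p: "p \<in> L" "p \<in> F" "x - p \<in> F" using hull_in_F by blast
      hence "p \<in> L \<inter> positive_octant" "x - p \<in> L \<inter> positive_octant"
        using v_pos diff_in[OF x(1)] by auto
      moreover have "x = p + (x - p)" by simp
      ultimately show False using ind by blast
    qed
  qed
qed

end

section \<open>Summation over a decomposition of the face\<close>

context face_plane
begin

definition indec_outside :: "(real^3) set" where
  "indec_outside = {x \<in> L \<inter> positive_octant.
     \<not> (\<exists>y z. y \<in> L \<inter> positive_octant \<and> z \<in> L \<inter> positive_octant \<and> x = y + z) \<and>
     x \<in> {t *\<^sub>R y | t y. t > 0 \<and> y \<in> F} - F}"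

text \<open>The box points of non-integral level over the triangles of \<open>T\<close> partition
  the indecomposables in question. As \<open>T\<close> is arbitrary, the result fits whichever
  decomposition \<open>IV\<close> selects.\<close>

lemma card_indec_outside:
  assumes T: "integer_decomposition L 2 F T"
  shows "int (card indec_outside) = (int (ID L F) - 1) * int (\<Sum>s\<in>T. simplex_IV L s)"
proof -
  have fin: "finite T" using T unfolding integer_decomposition_def by blast
  have U: "(\<Union>s\<in>T. convex hull (set s)) = F" using T unfolding integer_decomposition_def by blast
  have tri: "\<exists>v0 v1 v2. s = [v0, v1, v2] \<and> face_triangle L F a v0 v1 v2" if "s \<in> T" for s
  proof -
    have s: "length s = 3" "distinct s" "set s \<subseteq> L" "\<not> affine_dependent (set s)"
      using T that unfolding integer_decomposition_def by auto
    then obtain v0 v1 v2 where v: "s = [v0, v1, v2]"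
      by (auto simp: length_Suc_conv eval_nat_numeral)
    have "set s \<subseteq> convex hull (set s)" by (rule hull_subset)
    hence "set s \<subseteq> F" using U that by blast
    hence "face_triangle L F a v0 v1 v2" using s v by unfold_locales auto
    thus ?thesis using v by blast
  qed
  define N where "N = (\<lambda>s. {x \<in> L \<inter> halfopen_box (s ! 0) (s ! 1) (s ! 2). a \<bullet> x \<notin> \<int>})"
  have "indec_outside = (\<Union>s\<in>T. N s)"
  proof (intro equalityI subsetI)
    fix x assume x: "x \<in> indec_outside"
    then obtain t y where ty: "x = t *\<^sub>R y" "t > 0" "y \<in> F" unfolding indec_outside_def by blast
    then obtain s where s: "s \<in> T" "y \<in> convex hull (set s)" using U by blast
    obtain v0 v1 v2 where v: "s = [v0, v1, v2]" "face_triangle L F a v0 v1 v2" using tri[OF s(1)] by blast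
    have "x \<in> N s"
      using face_triangle.indecomposable_in_Par[OF v(2) _ ty(1,2)] x s(2) v(1)
      unfolding N_def indec_outside_def by auto
    thus "x \<in> (\<Union>s\<in>T. N s)" using s by blast
  next
    fix x assume "x \<in> (\<Union>s\<in>T. N s)"
    then obtain s where s: "s \<in> T" "x \<in> N s" by blast
    obtain v0 v1 v2 where v: "s = [v0, v1, v2]" "face_triangle L F a v0 v1 v2" using tri[OF s(1)] by blast
    have x: "x \<in> L" "x \<in> halfopen_box v0 v1 v2" "a \<bullet> x \<notin> \<int>" using s(2) v(1) by (auto simp: N_def)
    show "x \<in> indec_outside"
      unfolding indec_outside_def using face_triangle.Par_nonint_indecomposable[OF v(2) x] x(1) by blast
  qed
  also have "card (\<Union>s\<in>T. N s) = (\<Sum>s\<in>T. card (N s))"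
  proof (rule card_UN_disjoint[OF fin])
    show "\<forall>s\<in>T. finite (N s)"
    proof
      fix s assume "s \<in> T"
      then obtain v0 v1 v2 where v: "s = [v0, v1, v2]" "face_triangle L F a v0 v1 v2" using tri by blast
      have "N s \<subseteq> L \<inter> halfopen_box v0 v1 v2" by (auto simp: N_def v(1))
      thus "finite (N s)" by (rule finite_subset[OF _ face_triangle.finite_L_Par[OF v(2)]])
    qed
    show "\<forall>s\<in>T. \<forall>t\<in>T. s \<noteq> t \<longrightarrow> N s \<inter> N t = {}"
    proof (intro ballI impI, rule ccontr)
      fix s t assume st: "s \<in> T" "t \<in> T" "s \<noteq> t" "N s \<inter> N t \<noteq> {}"
      then obtain x where x: "x \<in> N s" "x \<in> N t" by blast
      have ri: "(1 / (a \<bullet> x)) *\<^sub>R x \<in> rel_interior (convex hull (set s))" if h: "s \<in> T" "x \<in> N s" for s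
      proof -
        obtain v0 v1 v2 where v: "s = [v0, v1, v2]" "face_triangle L F a v0 v1 v2" using tri[OF h(1)] by blast
        show ?thesis using face_triangle.Par_nonint_rel_interior[OF v(2)] h(2) by (simp add: N_def v(1))
      qed
      have "rel_interior (convex hull (set s)) \<inter> rel_interior (convex hull (set t)) = {}"
        using T st unfolding integer_decomposition_def by blast
      thus False using ri[OF st(1) x(1)] ri[OF st(2) x(2)] by blast
    qed
  qed
  also have "int (\<Sum>s\<in>T. card (N s)) = (\<Sum>s\<in>T. (int (ID L F) - 1) * int (simplex_IV L s))"
    unfolding of_nat_sum
  proof (rule sum.cong[OF refl])
    fix s assume "s \<in> T"
    then obtain v0 v1 v2 where v: "s = [v0, v1, v2]" "face_triangle L F a v0 v1 v2" using tri by blast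
    have "N s = {x \<in> L \<inter> halfopen_box v0 v1 v2. a \<bullet> x \<notin> \<int>}" by (simp add: N_def v(1))
    thus "int (card (N s)) = (int (ID L F) - 1) * int (simplex_IV L s)"
      using face_triangle.card_Par_nonint[OF v(2)] v(1) by simp
  qed
  finally show ?thesis by (simp add: sum_distrib_left)
qed

end

section \<open>Triangulations\<close>

text \<open>Grouping the barycentric weights of \<open>p\<close> and \<open>q\<close> places
  \<open>x\<close> on the ray from \<open>v\<close> through an inner point \<open>y\<close> of the
  opposite edge. This reduces disjointness of triangles with common apex to a comparison of
  edges.\<close>

lemma rel_interior_triangle_apex:
  fixes v p q :: "'a::euclidean_space"
  assumes indep: "\<not> affine_dependent {v, p, q}" and dist: "distinct [v, p, q]"
    and x: "x \<in> rel_interior (convex hull {v, p, q})"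
  shows "\<exists>y s. y \<in> rel_interior (closed_segment p q) \<and> 0 < s \<and> x = (1 - s) *\<^sub>R v + s *\<^sub>R y"
proof -
  obtain u where u: "\<forall>z\<in>{v, p, q}. 0 < u z" "sum u {v, p, q} = 1" "(\<Sum>z\<in>{v, p, q}. u z *\<^sub>R z) = x"
    using x unfolding rel_interior_convex_hull_explicit[OF indep] by blast
  define s where "s = u p + u q"
  have pos: "u v > 0" "u p > 0" "u q > 0" using u(1) by auto
  have s: "s > 0" "u v = 1 - s" using u(2) dist pos by (auto simp: s_def)
  define k where "k = u q / s"
  define y where "y = (1 - k) *\<^sub>R p + k *\<^sub>R q"
  have k: "0 < k" "k < 1" "1 - k = u p / s" using s pos by (simp_all add: k_def s_def field_simps)
  have sy: "s *\<^sub>R y = u p *\<^sub>R p + u q *\<^sub>R q"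
    unfolding y_def k(3) using s(1) by (simp add: k_def scaleR_right_distrib)
  have "y \<in> open_segment p q" unfolding in_segment using dist k y_def by auto
  hence "y \<in> rel_interior (closed_segment p q)" using dist by (simp add: rel_interior_closed_segment)
  moreover have "x = (1 - s) *\<^sub>R v + s *\<^sub>R y"
    using u(3) dist unfolding sy by (simp add: s(2)[symmetric])
  ultimately show ?thesis using s(1) by blast
qed

text \<open>Cone from an extreme point \<open>v\<close> over the edges that miss \<open>v\<close>. A ray from \<open>v\<close> through a relative interior point
  leaves the polygon through such an edge, so the triangles cover a dense subset.\<close>

lemma integer_decomposition_exists:
  fixes F :: "(real^3) set"
  assumes S: "finite S" "S \<subseteq> L" and F: "F = convex hull S" and dim: "aff_dim F = 2"
  shows "\<exists>T. integer_decomposition L 2 F T"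
proof -
  have poly: "polytope F" using S F unfolding polytope_def by blast
  have cpt: "compact F" and conv: "convex F"
    using poly by (simp_all add: polytope_imp_compact polytope_imp_convex)
  have ne: "F \<noteq> {}" using dim by auto
  obtain v where v: "v extreme_point_of F" using extreme_point_exists_convex[OF cpt conv ne] .
  have vF: "v \<in> F" using v by (simp add: extreme_point_of_def)
  have vS: "v \<in> S" using v extreme_point_of_convex_hull unfolding F by blast
  have v_ri: "v \<notin> rel_interior F"
    using v dim by (intro extreme_point_not_in_REL_INTERIOR) auto
  define E where "E = {e. e facet_of F \<and> v \<notin> e}"
  have finE: "finite E" using finite_polytope_facets[OF poly] by (simp add: E_def)
  \<comment> \<open>A facet of a polygon is compact, convex and one-dimensional, hence a segment.
    Its endpoints are extreme points of the polygon and so belong to the generating set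
    \<open>S\<close>.\<close>
  have edge: "\<exists>pq. e = closed_segment (fst pq) (snd pq) \<and> fst pq \<noteq> snd pq \<and> fst pq \<in> S \<and> snd pq \<in> S"
    if e: "e \<in> E" for e
  proof -
    have face: "e face_of F" and d1: "aff_dim e = 1" and "e \<noteq> {}"
      using e dim by (auto simp: E_def facet_of_def)
    have "compact e" "convex e"
      using face cpt conv face_of_imp_compact face_of_imp_convex by blast+
    moreover have "collinear e" using d1 by (simp add: collinear_aff_dim)
    ultimately obtain p q where pq: "e = closed_segment p q"
      using compact_convex_collinear_segment[OF \<open>e \<noteq> {}\<close>] by blast
    have "p \<noteq> q" using d1 pq by auto
    moreover have "p extreme_point_of F" "q extreme_point_of F"
      using extreme_point_of_face[OF face] by (auto simp: pq extreme_point_of_segment)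
    hence "p \<in> S" "q \<in> S" using extreme_point_of_convex_hull unfolding F by blast+
    ultimately show ?thesis using pq by (intro exI[of _ "(p, q)"]) auto
  qed
  define r where "r = (\<lambda>e. SOME pq. e = closed_segment (fst pq) (snd pq) \<and> fst pq \<noteq> snd pq \<and> fst pq \<in> S \<and> snd pq \<in> S)"
  have r: "e = closed_segment (fst (r e)) (snd (r e))" "fst (r e) \<noteq> snd (r e)" "fst (r e) \<in> S" "snd (r e) \<in> S"
    if "e \<in> E" for e
    using someI_ex[OF edge[OF that]] unfolding r_def by blast+
  define tri where "tri = (\<lambda>e. [v, fst (r e), snd (r e)])"
  have set_tri: "set (tri e) = {v, fst (r e), snd (r e)}" for e by (simp add: tri_def)
  have indep: "\<not> affine_dependent {v, fst (r e), snd (r e)}" if e: "e \<in> E" for e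
  proof -
    have face: "e face_of F" and "v \<notin> e" using e by (auto simp: E_def facet_of_def)
    have "v \<notin> affine hull e"
      using face_of_imp_eq_affine_Int[OF conv face] vF \<open>v \<notin> e\<close> by blast
    moreover have "affine hull e = affine hull {fst (r e), snd (r e)}"
      using r(1)[OF e] by (metis affine_hull_convex_hull segment_convex_hull)
    ultimately have "v \<notin> affine hull {fst (r e), snd (r e)}" by simp
    thus ?thesis by (rule affine_independent_insert[OF affine_independent_2])
  qed
  have dist: "distinct (tri e)" if e: "e \<in> E" for e
  proof -
    have "v \<notin> closed_segment (fst (r e)) (snd (r e))" using r(1)[OF e] e by (simp add: E_def)
    hence "v \<noteq> fst (r e)" "v \<noteq> snd (r e)" by auto
    thus ?thesis using r(2)[OF e] by (simp add: tri_def)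
  qed
  have sub: "convex hull (set (tri e)) \<subseteq> F" if "e \<in> E" for e
    unfolding F set_tri using r(3,4)[OF that] vS by (intro hull_mono) auto
  have cover: "(\<Union>e\<in>E. convex hull (set (tri e))) = F"
  proof
    show "(\<Union>e\<in>E. convex hull (set (tri e))) \<subseteq> F" using sub by blast
    have "closed (\<Union>e\<in>E. convex hull (set (tri e)))"
      using finE by (intro closed_UN) (auto intro!: compact_imp_closed finite_imp_compact_convex_hull)
    moreover have "rel_interior F \<subseteq> (\<Union>e\<in>E. convex hull (set (tri e)))"
    proof
      fix x assume x: "x \<in> rel_interior F"
      have xF: "x \<in> F" using x rel_interior_subset by blast
      have "x \<noteq> v" using x v_ri by blast
      have "x + (x - v) \<in> affine hull F"
      proof -
        have "x + (x - v) = 2 *\<^sub>R x + (-1) *\<^sub>R v" by (simp add: scaleR_2)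
        thus ?thesis using mem_affine[OF affine_affine_hull, of x F v 2 "-1"] xF vF
          by (simp add: hull_inc)
      qed
      moreover have "x - v \<noteq> 0" using \<open>x \<noteq> v\<close> by simp
      ultimately obtain d where d: "0 < d" "x + d *\<^sub>R (x - v) \<in> rel_frontier F"
        using ray_to_rel_frontier[OF compact_imp_bounded[OF cpt] x] by blast
      \<comment> \<open>The point where the ray from \<open>v\<close> through \<open>x\<close>
        leaves the polygon, so \<open>x\<close> lies strictly between \<open>v\<close> and
        \<open>y\<close>. A facet containing both \<open>v\<close> and \<open>y\<close> would
        contain \<open>x\<close>, which is a relative interior point.\<close>
      define y where "y = x + d *\<^sub>R (x - v)"
      obtain e where e: "e facet_of F" "y \<in> e"
        using d(2) rel_frontier_of_polyhedron[OF polytope_imp_polyhedron[OF poly]] unfolding y_def by blast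
      have "e face_of F" "e \<noteq> F" using e(1) by (auto simp: facet_of_def)
      have "(1 + d) *\<^sub>R x = d *\<^sub>R v + y" by (simp add: y_def algebra_simps)
      hence "(1 / (1 + d)) *\<^sub>R ((1 + d) *\<^sub>R x) = (1 / (1 + d)) *\<^sub>R (d *\<^sub>R v + y)" by simp
      hence xvy: "x = (d / (1 + d)) *\<^sub>R v + (1 / (1 + d)) *\<^sub>R y"
        using d(1) by (simp add: scaleR_right_distrib)
      have cv: "x \<in> C" if "convex C" "v \<in> C" "y \<in> C" for C
        unfolding xvy using d(1) by (intro convexD[OF that]) (auto simp: field_simps)
      have "v \<notin> e"
      proof
        assume "v \<in> e"
        hence "x \<in> e" using cv[of e] face_of_imp_convex[OF \<open>e face_of F\<close>] e(2) conv by blast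
        thus False using face_of_disjoint_rel_interior[OF \<open>e face_of F\<close> \<open>e \<noteq> F\<close>] x by blast
      qed
      hence "e \<in> E" using e(1) by (simp add: E_def)
      have "e \<subseteq> convex hull (set (tri e))"
        unfolding set_tri by (subst r(1)[OF \<open>e \<in> E\<close>], unfold segment_convex_hull) (intro hull_mono, auto)
      hence "x \<in> convex hull (set (tri e))" using e(2) by (intro cv) (auto simp: set_tri intro: hull_inc)
      thus "x \<in> (\<Union>e\<in>E. convex hull (set (tri e)))" using \<open>e \<in> E\<close> by blast
    qed
    ultimately have "closure (rel_interior F) \<subseteq> (\<Union>e\<in>E. convex hull (set (tri e)))"
      by (rule closure_minimal[rotated])
    thus "F \<subseteq> (\<Union>e\<in>E. convex hull (set (tri e)))"
      using convex_closure_rel_interior[OF conv] closure_subset by blast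
  qed
  have disj: "rel_interior (convex hull (set (tri e))) \<inter> rel_interior (convex hull (set (tri e'))) = {}"
    if e: "e \<in> E" "e' \<in> E" "e \<noteq> e'" for e e'
  proof (rule ccontr)
    assume "\<not> ?thesis"
    then obtain x where x: "x \<in> rel_interior (convex hull (set (tri e)))"
      "x \<in> rel_interior (convex hull (set (tri e')))" by blast
    have dec: "\<exists>y s. y \<in> rel_interior e \<and> 0 < s \<and> x = (1 - s) *\<^sub>R v + s *\<^sub>R y"
      if "e \<in> E" "x \<in> rel_interior (convex hull (set (tri e)))" for e
      using rel_interior_triangle_apex[OF indep[OF that(1)]] dist[OF that(1)] that(2) r(1)[OF that(1)]
      by (simp add: tri_def)
    obtain y s where y: "y \<in> rel_interior e" "0 < s" "x = (1 - s) *\<^sub>R v + s *\<^sub>R y" using dec[OF e(1) x(1)] by blast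
    obtain y' s' where y': "y' \<in> rel_interior e'" "0 < s'" "x = (1 - s') *\<^sub>R v + s' *\<^sub>R y'"
      using dec[OF e(2) x(2)] by blast
    \<comment> \<open>If \<open>s < s'\<close>, then \<open>y'\<close> lies strictly between
      \<open>v\<close> and \<open>y\<close>, and the face property of \<open>e'\<close> forces
      \<open>v\<close> into \<open>e'\<close>. Equal parameters give \<open>y = y'\<close>, and
      faces whose relative interiors meet are equal.\<close>
    have bad: False
      if h: "e' \<in> E" "y \<in> F" "y' \<in> e'" "0 < s" "s < s'" "(1 - s) *\<^sub>R v + s *\<^sub>R y = (1 - s') *\<^sub>R v + s' *\<^sub>R y'"
      for e' y y' s s'
    proof -
      have face: "e' face_of F" and "v \<notin> e'" using h(1) by (auto simp: E_def facet_of_def)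
      have "s' *\<^sub>R y' = (s' - s) *\<^sub>R v + s *\<^sub>R y" using h(6) by (simp add: algebra_simps)
      hence "(1 / s') *\<^sub>R (s' *\<^sub>R y') = (1 / s') *\<^sub>R ((s' - s) *\<^sub>R v + s *\<^sub>R y)" by simp
      hence "y' = ((s' - s) / s') *\<^sub>R v + (s / s') *\<^sub>R y" using h(4,5) by (simp add: scaleR_right_distrib)
      moreover have "(s' - s) / s' = 1 - s / s'" using h(4,5) by (simp add: field_simps)
      ultimately have y': "y' = (1 - s / s') *\<^sub>R v + (s / s') *\<^sub>R y" by simp
      have "v \<noteq> y"
      proof
        assume "v = y"
        hence "y' = v" using y' by (simp add: algebra_simps)
        thus False using h(3) \<open>v \<notin> e'\<close> by simp
      qed
      hence "y' \<in> open_segment v y" unfolding in_segment using y' h(4,5)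
        by (auto intro!: exI[of _ "s / s'"])
      hence "v \<in> e'" using face_ofD[OF face _ vF h(2) h(3)] by blast
      thus False using \<open>v \<notin> e'\<close> by blast
    qed
    have face: "e face_of F" "e' face_of F" using e by (auto simp: E_def facet_of_def)
    have in_e: "y \<in> e" "y' \<in> e'" using y(1) y'(1) rel_interior_subset by blast+
    have in_F: "y \<in> F" "y' \<in> F" using in_e face face_of_imp_subset by blast+
    consider "s < s'" | "s' < s" | "s = s'" by linarith
    thus False
    proof cases
      case 1
      show False by (rule bad[OF e(2) in_F(1) in_e(2) y(2) 1]) (use y(3) y'(3) in simp)
    next
      case 2
      show False by (rule bad[OF e(1) in_F(2) in_e(1) y'(2) 2]) (use y(3) y'(3) in simp)
    next
      case 3
      hence "(1 - s) *\<^sub>R v + s *\<^sub>R y = (1 - s) *\<^sub>R v + s *\<^sub>R y'" using y(3) y'(3) by metis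
      hence "y = y'" using y(2) by simp
      thus False using face_of_eq[OF face] y(1) y'(1) e(3) by blast
    qed
  qed
  have "integer_decomposition L 2 F (tri ` E)"
    unfolding integer_decomposition_def
  proof (intro conjI)
    show "finite (tri ` E)" using finE by simp
    show "\<forall>s\<in>tri ` E. length s = 2 + 1 \<and> distinct s \<and> set s \<subseteq> L \<and> \<not> affine_dependent (set s)"
    proof (intro ballI)
      fix s assume "s \<in> tri ` E"
      then obtain e where e: "e \<in> E" "s = tri e" by blast
      have "set s \<subseteq> L" using r(3,4)[OF e(1)] vS S(2) unfolding e(2) set_tri by blast
      moreover have "length s = 2 + 1" by (simp add: e(2) tri_def)
      ultimately show "length s = 2 + 1 \<and> distinct s \<and> set s \<subseteq> L \<and> \<not> affine_dependent (set s)"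
        using dist[OF e(1)] indep[OF e(1)] unfolding e(2) set_tri by blast
    qed
    show "\<Union> ((\<lambda>s. convex hull set s) ` tri ` E) = F" using cover by (simp add: image_image)
    show "\<forall>s\<in>tri ` E. \<forall>t\<in>tri ` E. s \<noteq> t \<longrightarrow>
        rel_interior (convex hull set s) \<inter> rel_interior (convex hull set t) = {}"
      using disj by blast
  qed
  thus ?thesis by blast
qed

section \<open>Faces of the sail\<close>

text \<open>In a convex combination that attains the bound, the nonnegative terms
  \<open>u s * (a \<bullet> s - b)\<close> sum to 0, so every point with nonzero weight lies on the
  hyperplane.\<close>

lemma convex_hull_Int_supporting_hyperplane:
  fixes S :: "'a::euclidean_space set"
  assumes ge: "\<And>x. x \<in> S \<Longrightarrow> a \<bullet> x \<ge> b" and x: "x \<in> convex hull S" "a \<bullet> x = b"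
  shows "x \<in> convex hull {s \<in> S. a \<bullet> s = b}"
proof -
  obtain t u where t: "finite t" "t \<subseteq> S" "\<forall>s\<in>t. 0 \<le> u s" "sum u t = 1" "(\<Sum>s\<in>t. u s *\<^sub>R s) = x"
    using x(1) unfolding convex_hull_explicit by blast
  have "(\<Sum>s\<in>t. u s * (a \<bullet> s - b)) = (\<Sum>s\<in>t. u s * (a \<bullet> s)) - (\<Sum>s\<in>t. u s) * b"
    by (simp add: algebra_simps sum_subtractf sum_distrib_left)
  also have "(\<Sum>s\<in>t. u s * (a \<bullet> s)) = a \<bullet> x" by (simp add: t(5)[symmetric] inner_sum_right)
  finally have "(\<Sum>s\<in>t. u s * (a \<bullet> s - b)) = 0" using t(4) x(2) by simp
  moreover have "\<forall>s\<in>t. u s * (a \<bullet> s - b) \<ge> 0" using t ge by (auto intro!: mult_nonneg_nonneg)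
  ultimately have z: "\<forall>s\<in>t. u s * (a \<bullet> s - b) = 0" 
    using sum_nonneg_eq_0_iff[OF t(1), of "\<lambda>s. u s * (a \<bullet> s - b)"] by blast
  define t' where "t' = {s \<in> t. u s \<noteq> 0}"
  have t': "finite t'" "t' \<subseteq> {s \<in> S. a \<bullet> s = b}" using t z by (auto simp: t'_def)
  have "sum u t' = 1" using t(1,4) by (subst t(4)[symmetric], intro sum.mono_neutral_left) (auto simp: t'_def)
  moreover have "(\<Sum>s\<in>t'. u s *\<^sub>R s) = x"
    using t(1) by (subst t(5)[symmetric], intro sum.mono_neutral_left) (auto simp: t'_def)
  moreover have "\<forall>s\<in>t'. 0 \<le> u s" using t(3) by (auto simp: t'_def)
  ultimately show ?thesis unfolding convex_hull_explicit using t' by blast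
qed

lemma convex_positive_octant: "convex positive_octant"
proof -
  have "positive_octant = (\<Inter>i. {x :: real^3. x $ i > 0})" by (auto simp: positive_octant_def)
  moreover have "convex {x :: real^3. x $ i > 0}" for i
    using convex_halfspace_gt[of 0 "axis i 1 :: real^3"] by (simp add: inner_axis')
  ultimately show ?thesis by (metis convex_INT)
qed

text \<open>Collects the arithmetic input for the study of faces. The all-ones vector is the image
  of the field element 1 and provides a lattice direction inside the octant.\<close>

locale sail_lattice = lattice_3 +
  assumes one_in: "1 \<in> L"
    and spanning: "\<exists>w :: 3 \<Rightarrow> real^3. (\<forall>i. w i \<in> L) \<and> (\<forall>x. \<exists>c. x = (\<Sum>i\<in>UNIV. c i *\<^sub>R w i))"
    and proportional: "u \<in> L \<Longrightarrow> v \<in> L \<Longrightarrow> v \<noteq> 0 \<Longrightarrow> i \<noteq> j \<Longrightarrow> u $ i * v $ j = u $ j * v $ i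
      \<Longrightarrow> \<exists>q. u = q *\<^sub>R v"
begin

definition Lp :: "(real^3) set" where "Lp = L \<inter> positive_octant"

lemma eventually_positive: "\<exists>n. x + real n *\<^sub>R 1 \<in> positive_octant"
proof -
  obtain n where "real n > norm x" using reals_Archimedean2 by blast
  hence "x $ i + real n > 0" for i using component_le_norm_cart[of x i] by linarith
  thus ?thesis unfolding positive_octant_def by auto
qed

text \<open>The lattice points \<open>1\<close> and \<open>1 + 1\<close> force \<open>b = 0\<close>.
  Every lattice vector enters the octant after adding a multiple of \<open>1\<close>, so
  \<open>a\<close> is orthogonal to the whole lattice, which spans the space.\<close>

lemma klein_not_in_hyperplane:
  assumes "a \<noteq> 0" "\<And>x. x \<in> Lp \<Longrightarrow> a \<bullet> x = b"
  shows False
proof -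
  have 1: "1 \<in> Lp" "1 + 1 \<in> Lp"
    using one_in add_in[OF one_in one_in] by (auto simp: Lp_def positive_octant_def)
  have "a \<bullet> 1 = b" "a \<bullet> (1 + 1) = b" using assms(2) 1 by blast+
  hence b: "b = 0" "a \<bullet> 1 = 0" by (simp_all only: inner_add_right)
  have "a \<bullet> w = 0" if "w \<in> L" for w
  proof -
    obtain n where n: "w + real n *\<^sub>R 1 \<in> positive_octant" using eventually_positive by blast
    have "w + real n *\<^sub>R 1 \<in> L" using that one_in by (intro add_in of_nat_scaleR_in)
    hence "a \<bullet> (w + real n *\<^sub>R 1) = b" using n assms(2) by (simp add: Lp_def)
    thus ?thesis using b by (simp add: inner_add_right)
  qed
  hence orth: "\<forall>w\<in>L. a \<bullet> w = 0" by blast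
  from spanning obtain w where w: "(\<forall>i. w i \<in> L) \<and> (\<forall>x. \<exists>c. x = (\<Sum>i\<in>(UNIV :: 3 set). c i *\<^sub>R w i))" ..
  from conjunct2[OF w] obtain c where c: "a = (\<Sum>i\<in>UNIV. c i *\<^sub>R w i)" by blast
  have "a \<bullet> (\<Sum>i\<in>UNIV. c i *\<^sub>R w i) = 0" using orth conjunct1[OF w] by (simp add: inner_sum_right)
  hence "a \<bullet> a = 0" unfolding c[symmetric] .
  thus False using assms(1) by simp
qed

text \<open>On \<open>Lp\<close>, a negative level would be unbounded below along multiples. A real
  point \<open>x\<close> of the octant is handled by lattice points within a fixed distance of
  \<open>n x\<close>: for large \<open>n\<close> they lie in the octant, and their levels would
  become negative if that of \<open>x\<close> were.\<close>

lemma nonneg_on_octant: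
  assumes ge: "\<And>x. x \<in> Lp \<Longrightarrow> a \<bullet> x \<ge> b" and x: "x \<in> positive_octant"
  shows "a \<bullet> x \<ge> 0"
proof -
  have Lp_ge: "a \<bullet> x \<ge> 0" if "x \<in> Lp" for x
  proof (rule ccontr)
    assume "\<not> ?thesis"
    hence neg: "- (a \<bullet> x) > 0" by simp
    obtain n where n: "- b < real n * (- (a \<bullet> x))" using reals_Archimedean3[OF neg] by blast
    obtain n :: nat where n: "- b < real n * (- (a \<bullet> x))" "n > 0"
    proof -
      have "real n * (- (a \<bullet> x)) \<le> real (Suc n) * (- (a \<bullet> x))" using neg by (intro mult_right_mono) auto
      thus ?thesis using that[of "Suc n"] n by simp
    qed
    have "real n *\<^sub>R x \<in> Lp" using \<open>x \<in> Lp\<close> n(2) unfolding Lp_def positive_octant_def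
      by (auto intro: of_nat_scaleR_in)
    from ge[OF this] have "real n * (a \<bullet> x) \<ge> b" by simp
    thus False using n(1) by simp
  qed
  obtain w where w: "\<And>i. w i \<in> L" "\<And>x. \<exists>c. x = (\<Sum>i\<in>(UNIV :: 3 set). c i *\<^sub>R w i)"
    using spanning by blast
  obtain c where c: "x = (\<Sum>i\<in>UNIV. c i *\<^sub>R w i)" using w(2) by blast
  define C where "C = (\<Sum>i\<in>UNIV. norm (w i))"
  \<comment> \<open>Coordinates of \<open>n x\<close> along the spanning lattice vectors are rounded
    down, so the error is bounded by \<open>C\<close> independently of \<open>n\<close>.\<close>
  define y where "y = (\<lambda>n::nat. \<Sum>i\<in>UNIV. of_int \<lfloor>real n * c i\<rfloor> *\<^sub>R w i)"
  have y_L: "y n \<in> L" for n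
    unfolding y_def using w(1) by (auto simp: sum_3 intro!: add_in of_int_scaleR_in)
  have near: "norm (y n - real n *\<^sub>R x) \<le> C" for n
  proof -
    have "y n - real n *\<^sub>R x = (\<Sum>i\<in>UNIV. (of_int \<lfloor>real n * c i\<rfloor> - real n * c i) *\<^sub>R w i)"
      by (simp add: y_def c scaleR_sum_right sum_subtractf scaleR_left_diff_distrib)
    also have "norm \<dots> \<le> (\<Sum>i\<in>UNIV. norm ((of_int \<lfloor>real n * c i\<rfloor> - real n * c i) *\<^sub>R w i))"
      by (rule norm_sum)
    also have "\<dots> \<le> C" unfolding C_def
    proof (intro sum_mono)
      fix i
      have "\<bar>of_int \<lfloor>real n * c i\<rfloor> - real n * c i\<bar> \<le> 1" by linarith
      thus "norm ((of_int \<lfloor>real n * c i\<rfloor> - real n * c i) *\<^sub>R w i) \<le> norm (w i)"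
        by (simp add: mult_left_le_one_le)
    qed
    finally show ?thesis .
  qed
  have xp: "x $ i > 0" for i using x by (simp add: positive_octant_def)
  define \<mu> where "\<mu> = min (x $ 1) (min (x $ 2) (x $ 3))"
  have \<mu>: "\<mu> > 0" "\<mu> \<le> x $ i" for i using xp exhaust_3[of i] by (auto simp: \<mu>_def)
  have y_pos: "y n \<in> positive_octant" if n: "real n * \<mu> > C" for n
  proof -
    have "y n $ i > 0" for i
    proof -
      have "\<bar>(y n - real n *\<^sub>R x) $ i\<bar> \<le> C" using component_le_norm_cart near order_trans by blast
      moreover have "real n * \<mu> \<le> real n * x $ i" using \<mu>(2) by (intro mult_left_mono) auto
      ultimately show ?thesis using n by simp
    qed
    thus ?thesis by (simp add: positive_octant_def)
  qed
  show ?thesis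
  proof (rule ccontr)
    assume "\<not> ?thesis"
    hence neg: "- (a \<bullet> x) > 0" by simp
    obtain n1 where n1: "C < real n1 * \<mu>" using reals_Archimedean3[OF \<mu>(1)] by blast
    obtain n2 where n2: "norm a * C < real n2 * (- (a \<bullet> x))" using reals_Archimedean3[OF neg] by blast
    define n where "n = max n1 n2"
    have "real n1 * \<mu> \<le> real n * \<mu>" using \<mu>(1) by (intro mult_right_mono) (auto simp: n_def)
    hence "y n \<in> Lp" using y_pos[of n] y_L n1 by (auto simp: Lp_def)
    hence "0 \<le> a \<bullet> y n" by (rule Lp_ge)
    also have "a \<bullet> y n = a \<bullet> (y n - real n *\<^sub>R x) + real n * (a \<bullet> x)" by (simp add: inner_diff_right)
    also have "a \<bullet> (y n - real n *\<^sub>R x) \<le> norm a * C"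
      using norm_cauchy_schwarz[of a "y n - real n *\<^sub>R x"] near[of n]
      by (meson mult_left_mono norm_ge_zero order_trans)
    also have "norm a * C < real n2 * (- (a \<bullet> x))" by (rule n2)
    also have "\<dots> \<le> real n * (- (a \<bullet> x))" using neg by (intro mult_right_mono) (auto simp: n_def)
    finally show False by simp
  qed
qed

lemma coordinates_nonneg:
  assumes "\<And>x. x \<in> Lp \<Longrightarrow> a \<bullet> x \<ge> b"
  shows "a $ i \<ge> 0"
proof (rule ccontr)
  assume "\<not> ?thesis"
  hence neg: "a $ i < 0" by simp
  \<comment> \<open>Chosen so that the point \<open>K\<close> times the i-th axis vector plus
    \<open>1\<close> has level at most -1; adding \<open>1\<close> moves it off the boundary of the
    octant.\<close>
  define K where "K = (\<bar>a \<bullet> 1\<bar> + 1) / (- (a $ i))"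
  have K: "K > 0" "K * a $ i = - (\<bar>a \<bullet> 1\<bar> + 1)" using neg by (simp_all add: K_def field_simps)
  have "K *\<^sub>R axis i 1 + 1 \<in> positive_octant"
    using K(1) by (auto simp: positive_octant_def axis_def)
  from nonneg_on_octant[OF assms this] have "K * a $ i + a \<bullet> 1 \<ge> 0"
    by (simp add: inner_add_right inner_axis)
  thus False using K(2) by linarith
qed

lemma sail_face_plane:
  assumes "sail_face_2 L F"
  shows "\<exists>a. face_plane L F a" and "\<exists>T. integer_decomposition L 2 F T"
proof -
  define P where "P = klein_polyhedron L"
  have P: "P = convex hull Lp" by (simp add: P_def klein_polyhedron_def Lp_def)
  have convP: "convex P" by (simp add: P)
  have face: "F face_of P" and dim: "aff_dim F = 2" using assms by (auto simp: sail_face_2_def P_def)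
  have "F \<noteq> P"
  proof
    assume "F = P"
    hence "aff_dim P < DIM(real^3)" using dim by simp
    then obtain a b where a: "a \<noteq> 0" "P \<subseteq> {x. a \<bullet> x = b}" by (rule aff_lowdim_subset_hyperplane)
    have "Lp \<subseteq> P" unfolding P by (rule hull_subset)
    hence "a \<bullet> x = b" if "x \<in> Lp" for x using a(2) that by blast
    thus False by (rule klein_not_in_hyperplane[OF a(1)])
  qed
  have convF: "convex F" using face by (rule face_of_imp_convex)
  have "F \<noteq> {}" using dim by auto
  \<comment> \<open>A relative interior point is taken because a face of \<open>P\<close> through it
    contains all of \<open>F\<close>; this applies to the face cut out by a supporting hyperplane at
    \<open>z\<close>.\<close>
  then obtain z where z: "z \<in> rel_interior F" using convF rel_interior_eq_empty by blast
  have zF: "z \<in> F" using z rel_interior_subset by blast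
  have zP: "z \<in> P" using zF face face_of_imp_subset by blast
  have "z \<notin> rel_interior P" using face_of_disjoint_rel_interior[OF face \<open>F \<noteq> P\<close>] zF by blast
  moreover have "z \<in> closure P" using zP closure_subset by blast
  ultimately obtain a where a: "a \<noteq> 0" "\<And>y. y \<in> closure P \<Longrightarrow> a \<bullet> z \<le> a \<bullet> y"
    using supporting_hyperplane_relative_frontier[OF convP] by metis
  define b where "b = a \<bullet> z"
  have geP: "a \<bullet> y \<ge> b" if "y \<in> P" for y using a(2) that closure_subset by (auto simp: b_def)
  have Lp_P: "Lp \<subseteq> P" unfolding P by (rule hull_subset)
  have ge: "a \<bullet> y \<ge> b" if "y \<in> Lp" for y using geP that Lp_P by blast
  have "P \<inter> {x. a \<bullet> x = b} face_of P"
    using convP geP by (rule face_of_Int_supporting_hyperplane_ge)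
  hence "F \<subseteq> P \<inter> {x. a \<bullet> x = b}"
    by (rule subset_of_face_of) (use face face_of_imp_subset z zP in \<open>auto simp: b_def\<close>)
  hence F_sub: "F \<subseteq> {x. a \<bullet> x = b}" by blast
  have "affine hull F = {x. a \<bullet> x = b}"
  proof (rule affine_dim_equal)
    show "affine hull F \<subseteq> {x. a \<bullet> x = b}" using F_sub by (simp add: hull_minimal affine_hyperplane)
    show "aff_dim (affine hull F) = aff_dim {x. a \<bullet> x = b}" using a(1) dim by simp
  qed (use \<open>F \<noteq> {}\<close> in \<open>auto simp: affine_hyperplane\<close>)
  hence F_eq: "F = {x. a \<bullet> x = b} \<inter> P" using face_of_imp_eq_affine_Int[OF convP face] by simp
  define A where "A = {s \<in> Lp. a \<bullet> s = b}"
  have A_F: "A \<subseteq> F" unfolding F_eq A_def using Lp_P by blast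
  have F_hull: "F = convex hull A"
  proof
    show "F \<subseteq> convex hull A"
      using convex_hull_Int_supporting_hyperplane[OF ge] unfolding F_eq P A_def by blast
    show "convex hull A \<subseteq> F" using A_F convF by (rule hull_minimal)
  qed
  have a_nn: "a $ i \<ge> 0" for i using coordinates_nonneg[OF ge] by blast
  have A_dim: "aff_dim A = 2" using dim by (simp add: F_hull aff_dim_convex_hull)
  then obtain l where l: "l \<in> A" by fastforce
  have in3: "a \<bullet> x = a $ 1 * x $ 1 + a $ 2 * x $ 2 + a $ 3 * x $ 3" for x
    by (simp add: inner_vec_def sum_3)
  have "\<not> collinear A" using A_dim by (simp add: collinear_aff_dim)
  \<comment> \<open>With the i-th coordinate of \<open>a\<close> zero, all differences of points of
    \<open>A\<close> satisfy one nontrivial relation between their j-th and k-th coordinates, so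
    these pairs are proportional. By \<open>proportional\<close> the differences themselves are
    multiples of one vector, whereas \<open>A\<close> spans a plane.\<close>
  have coll: False if ijk: "{i, j, k} = (UNIV :: 3 set)" "i \<noteq> j" "i \<noteq> k" "j \<noteq> k" and ai: "a $ i = 0" for i j k
  proof -
    have in2: "a \<bullet> x = a $ j * x $ j + a $ k * x $ k" for x
    proof -
      have "a \<bullet> x = (\<Sum>m\<in>{i, j, k}. a $ m * x $ m)" by (simp add: inner_vec_def ijk(1))
      also have "\<dots> = a $ i * x $ i + (a $ j * x $ j + a $ k * x $ k)" using ijk(2-4) by simp
      finally show ?thesis using ai by simp
    qed
    have nz: "a $ j \<noteq> 0 \<or> a $ k \<noteq> 0"
    proof (rule ccontr)
      assume "\<not> ?thesis"
      hence "a $ m = 0" for m using ai ijk(1) by (metis UNIV_I insertE empty_iff)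
      thus False using a(1) by (simp add: vec_eq_iff)
    qed
    have "collinear A"
    proof (cases "\<exists>x0 y0. x0 \<in> A \<and> y0 \<in> A \<and> x0 \<noteq> y0")
      case False
      thus ?thesis unfolding collinear_def by (intro exI[of _ 0]) auto
    next
      case True
      then obtain x0 y0 where xy0: "x0 \<in> A" "y0 \<in> A" "x0 \<noteq> y0" by blast
      define u where "u = x0 - y0"
      have u: "u \<in> L" "u \<noteq> 0" "a \<bullet> u = 0" using xy0
        by (auto simp: u_def A_def Lp_def inner_diff_right intro: diff_in)
      have "\<exists>c. x - y = c *\<^sub>R u" if "x \<in> A" "y \<in> A" for x y
      proof -
        define d where "d = x - y"
        have d: "d \<in> L" "a \<bullet> d = 0" using that
          by (auto simp: d_def A_def Lp_def inner_diff_right intro: diff_in)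
        have e: "a $ j * d $ j = - (a $ k * d $ k)" "a $ j * u $ j = - (a $ k * u $ k)"
          using d(2) u(3) unfolding in2 by linarith+
        have "a $ j * (d $ j * u $ k - d $ k * u $ j) = (a $ j * d $ j) * u $ k - (a $ j * u $ j) * d $ k"
          by (simp add: algebra_simps)
        also have "\<dots> = 0" unfolding e by simp
        finally have "a $ j * (d $ j * u $ k - d $ k * u $ j) = 0" .
        moreover have "a $ k * (d $ j * u $ k - d $ k * u $ j) = (a $ k * u $ k) * d $ j - (a $ k * d $ k) * u $ j"
          by (simp add: algebra_simps)
        hence "a $ k * (d $ j * u $ k - d $ k * u $ j) = - (a $ j * u $ j) * d $ j + (a $ j * d $ j) * u $ j"
          using e by simp
        hence "a $ k * (d $ j * u $ k - d $ k * u $ j) = 0" by simp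
        ultimately have "d $ j * u $ k = d $ k * u $ j" using nz by auto
        thus ?thesis using proportional[OF d(1) u(1,2) ijk(4)] by (simp add: d_def)
      qed
      thus ?thesis unfolding collinear_def by blast
    qed
    thus False using \<open>\<not> collinear A\<close> by blast
  qed
  have "{1, 2, 3} = (UNIV :: 3 set)" "{2, 1, 3} = (UNIV :: 3 set)" "{3, 1, 2} = (UNIV :: 3 set)"
    unfolding UNIV_3 by blast+
  note coll = this[THEN coll]
  have "a $ 1 \<noteq> 0" by (rule notI, rule coll(1)) simp_all
  moreover have "a $ 2 \<noteq> 0" by (rule notI, rule coll(2)) simp_all
  moreover have "a $ 3 \<noteq> 0" by (rule notI, rule coll(3)) simp_all
  ultimately have a_pos: "a $ i > 0" for i using a_nn[of i] exhaust_3[of i] by force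
  have l_pos: "l $ i > 0" for i using l by (simp add: A_def Lp_def positive_octant_def)
  have "a \<bullet> l > 0" unfolding in3 using a_pos l_pos by (intro add_pos_pos mult_pos_pos)
  hence b_pos: "b > 0" using l by (simp add: A_def)
  have F_pos: "F \<subseteq> positive_octant"
    unfolding F_hull using convex_positive_octant by (intro hull_minimal) (auto simp: A_def Lp_def)
  have "face_plane L F ((1 / b) *\<^sub>R a)"
  proof unfold_locales
    show "1 \<le> ((1 / b) *\<^sub>R a) \<bullet> x" if "x \<in> L" "x \<in> positive_octant" for x
      using ge[of x] that b_pos by (simp add: Lp_def field_simps)
    show "((1 / b) *\<^sub>R a) \<bullet> x = 1" if "x \<in> F" for x using F_sub that b_pos by auto
  qed (rule F_pos, rule convF)
  thus "\<exists>a. face_plane L F a" by blast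
  \<comment> \<open>Since all terms are positive, each coordinate of a point of \<open>A\<close> is
    at most b divided by the matching coordinate of \<open>a\<close>; discreteness does the
    rest.\<close>
  have "finite A"
  proof -
    have "bounded {x. a \<bullet> x = b \<and> x \<in> positive_octant}"
    proof (rule boundedI)
      fix x assume "x \<in> {x. a \<bullet> x = b \<and> x \<in> positive_octant}"
      hence x: "a \<bullet> x = b" "\<And>i. x $ i > 0" by (auto simp: positive_octant_def)
      have "x $ i \<le> b / a $ i" for i
      proof -
        have "a $ i * x $ i \<le> (\<Sum>m\<in>UNIV. a $ m * x $ m)"
          using a_pos x(2) by (intro member_le_sum) (auto intro: less_imp_le)
        also have "\<dots> = b" using x(1) by (simp add: inner_vec_def)
        finally show ?thesis using a_pos[of i] by (simp add: field_simps)
      qed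
      hence "(\<Sum>i\<in>UNIV. \<bar>x $ i\<bar>) \<le> (\<Sum>i\<in>UNIV. b / a $ i)" using x(2) by (intro sum_mono) (simp add: abs_of_pos)
      thus "norm x \<le> (\<Sum>i\<in>UNIV. b / a $ i)" using norm_le_l1_cart order_trans by blast
    qed
    hence "finite (L \<inter> {x. a \<bullet> x = b \<and> x \<in> positive_octant})" by (rule finite_Int_bounded)
    thus ?thesis by (rule rev_finite_subset) (auto simp: A_def Lp_def)
  qed
  moreover have "A \<subseteq> L" by (auto simp: A_def Lp_def)
  ultimately show "\<exists>T. integer_decomposition L 2 F T"
    using F_hull dim by (rule integer_decomposition_exists)
qed

end

section \<open>Return from the lattice to the number field\<close>

sublocale totally_real_cubic \<subseteq> sail_lattice "Lambda \<tau>1 \<tau>2 \<tau>3"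
  using zero_in_L add_in_L uminus_in_L norm_ge_1 one_in_L proportional_in_L
proof unfold_locales
  show "\<exists>w :: 3 \<Rightarrow> real^3. (\<forall>i. w i \<in> L) \<and> (\<forall>x. \<exists>c. x = (\<Sum>i\<in>UNIV. c i *\<^sub>R w i))"
    using spanning_in_L by metis
qed

context totally_real_cubic
begin

lemma totally_positive_iota: "x \<in> totally_positive \<tau>1 \<tau>2 \<tau>3 \<longleftrightarrow> \<iota> x \<in> L \<inter> positive_octant"
  by (auto simp: totally_positive_def Lambda_def positive_octant_def forall_3 iota_eq_iff)

lemma indecomposable_iota:
  "indecomposable \<tau>1 \<tau>2 \<tau>3 x \<longleftrightarrow> \<iota> x \<in> L \<inter> positive_octant \<and>
     \<not> (\<exists>y z. y \<in> L \<inter> positive_octant \<and> z \<in> L \<inter> positive_octant \<and> \<iota> x = y + z)"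
proof -
  have "(\<exists>b c. b \<in> totally_positive \<tau>1 \<tau>2 \<tau>3 \<and> c \<in> totally_positive \<tau>1 \<tau>2 \<tau>3 \<and> x = b + c) \<longleftrightarrow>
      (\<exists>y z. y \<in> L \<inter> positive_octant \<and> z \<in> L \<inter> positive_octant \<and> \<iota> x = y + z)" (is "?l \<longleftrightarrow> ?r")
  proof
    assume ?l
    thus ?r using totally_positive_iota iota_add by blast
  next
    assume ?r
    then obtain y z where yz: "y \<in> L \<inter> positive_octant" "z \<in> L \<inter> positive_octant" "\<iota> x = y + z" by blast
    then obtain b c where bc: "y = \<iota> b" "z = \<iota> c" unfolding Lambda_def by blast
    have "x = b + c" using yz(3) unfolding bc iota_add[symmetric] iota_eq_iff .
    thus ?l using yz(1,2) unfolding bc totally_positive_iota[symmetric] by blast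
  qed
  thus ?thesis unfolding indecomposable_def totally_positive_iota by blast
qed

lemma iota_int_eq:
  assumes "face_plane L F a"
  shows "iota_int \<tau>1 \<tau>2 \<tau>3 F = card (face_plane.indec_outside L F)"
proof -
  define C where "C = {t *\<^sub>R x | t x. t > 0 \<and> x \<in> F} - F"
  define D where "D = {x. \<not> (\<exists>y z. y \<in> L \<inter> positive_octant \<and> z \<in> L \<inter> positive_octant \<and> x = y + z)}"
  have out: "face_plane.indec_outside L F = {x \<in> L \<inter> positive_octant. x \<in> D \<and> x \<in> C}"
    unfolding face_plane.indec_outside_def[OF assms] C_def D_def mem_Collect_eq ..
  have ind: "indecomposable \<tau>1 \<tau>2 \<tau>3 x \<longleftrightarrow> \<iota> x \<in> L \<inter> positive_octant \<and> \<iota> x \<in> D" for x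
    unfolding indecomposable_iota D_def mem_Collect_eq ..
  have L_range: "L \<subseteq> range \<iota>" by (auto simp: Lambda_def)
  have "\<iota> ` {x. indecomposable \<tau>1 \<tau>2 \<tau>3 x \<and> \<iota> x \<in> C} = face_plane.indec_outside L F" (is "\<iota> ` ?S = _")
    using L_range unfolding out ind by blast
  hence "card (face_plane.indec_outside L F) = card (\<iota> ` ?S)" by (rule arg_cong[OF sym])
  also have "\<dots> = card ?S" by (rule card_image) (simp add: inj_on_def iota_eq_iff)
  finally show ?thesis unfolding iota_int_def C_def by (rule sym)
qed

end

theorem theorem2p7:
  fixes \<tau>1 \<tau>2 \<tau>3 :: "'k::field_char_0 \<Rightarrow> real"
    and F :: "(real^3) set"
  assumes "degree_three_over_Q TYPE('k)"
    and "real_embedding \<tau>1" and "real_embedding \<tau>2" and "real_embedding \<tau>3"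
    and "\<tau>1 \<noteq> \<tau>2" and "\<tau>1 \<noteq> \<tau>3" and "\<tau>2 \<noteq> \<tau>3"
    and "sail_face_2 (Lambda \<tau>1 \<tau>2 \<tau>3) F"
  shows "int (iota_int \<tau>1 \<tau>2 \<tau>3 F)
           = (int (ID (Lambda \<tau>1 \<tau>2 \<tau>3) F) - 1) * int (IV (Lambda \<tau>1 \<tau>2 \<tau>3) F)"
proof -
  interpret totally_real_cubic \<tau>1 \<tau>2 \<tau>3 by unfold_locales (rule assms)+
  obtain a where a: "face_plane L F a" using sail_face_plane(1)[OF assms(8)] by blast
  have dim: "nat (aff_dim F) = 2" using assms(8) by (simp add: sail_face_2_def)
  have "\<exists>n T. integer_decomposition L (nat (aff_dim F)) F T \<and> n = (\<Sum>s\<in>T. simplex_IV L s)"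
    using sail_face_plane(2)[OF assms(8)] dim by simp
  \<comment> \<open>\<open>T\<close> is a decomposition realising the value that \<open>IV\<close>
    selects.\<close>
  from someI_ex[OF this] obtain T
    where T: "integer_decomposition L 2 F T" "IV L F = (\<Sum>s\<in>T. simplex_IV L s)"
    unfolding IV_def dim by blast
  show ?thesis
    unfolding iota_int_eq[OF a] face_plane.card_indec_outside[OF a T(1)] T(2) by simp
qed

end
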